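(* Let $(C,b,T_{\mathsf d},T_{\mathsf u})$ be an oriented quantum coalgebra over the field $k$ and let $\mathcal C=C\oplus C^{cop}$ be the direct sum of the coalgebras $C$ and $C^{cop}$. Then: (a) $(\mathcal C,\boldsymbol\beta,\mathbf S)$ is a quantum coalgebra over $k$, where the bilinear form $\boldsymbol\beta$ on $\mathcal C$ is determined by $$\boldsymbol\beta(c,d)=b(c,d)=\boldsymbol\beta(\overline c,\overline d),\qquad\boldsymbol\beta(\overline c,d)=b^{-1}(c,d),\qquad\boldsymbol\beta(c,\overline d)=b^{-1}(c,T_{\mathsf d}^{-1}\circ T_{\mathsf u}^{-1}(d))$$ and $\mathbf S(c\oplus d)=T_{\mathsf d}^{-1}\circ T_{\mathsf u}^{-1}(d)\oplus c$ for all $c,d\in C$. (b) $(\mathcal C,\boldsymbol\beta,\mathbf T_{\mathsf d},\mathbf T_{\mathsf u})$ is an oriented quantum coalgebra over $k$ and $\mathbf T_{\mathsf d},\mathbf T_{\mathsf u}$ commute with $\mathbf S$, where $\mathbf T_{\mathsf d}(c\oplus d)=T_{\mathsf d}(c)\oplus T_{\mathsf d}(d)$ and $\mathbf T_{\mathsf u}(c\oplus d)=T_{\mathsf u}(c)\oplus T_{\mathsf u}(d)$ for all $c,d\in C$. (c) The inclusion $\imath:C\to\mathcal C$, $\imath(c)=c\oplus0$, induces a morphism of oriented quantum coalgebras $\imath:(C,b,T_{\mathsf d},T_{\mathsf u})\to(\mathcal C,\boldsymbol\beta,\mathbf T_{\mathsf d},\mathbf T_{\mathsf u})$.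
   Context: $k$ is a field. For a coalgebra $(C,\Delta,\epsilon)$ over $k$ write $\Delta(c)=c_{(1)}\otimes c_{(2)}$ (summation understood); $C^{cop}$ is $C$ with coproduct $c\mapsto c_{(2)}\otimes c_{(1)}$. A bilinear form $b:C\times C\to k$ is invertible, with inverse $b^{-1}$, if $b^{-1}(c_{(1)},d_{(1)})b(c_{(2)},d_{(2)})=\epsilon(c)\epsilon(d)=b(c_{(1)},d_{(1)})b^{-1}(c_{(2)},d_{(2)})$ for all $c,d\in C$. A linear automorphism $T$ of $C$ is a coalgebra automorphism of $C$ with respect to a set $\mathcal S$ of bilinear forms on $C$ if $\epsilon\circ T=\epsilon$ and $b(T(c_{(1)}),d)\,b'(T(c_{(2)}),e)=b(T(c)_{(1)},d)\,b'(T(c)_{(2)},e)$ and $b(d,T(c_{(1)}))\,b'(e,T(c_{(2)}))=b(d,T(c)_{(1)})\,b'(e,T(c)_{(2)})$ for all $b,b'\in\mathcal S$ and $c,d,e\in C$. An oriented quantum coalgebra over $k$ is a quadruple $(C,b,T_{\mathsf d},T_{\mathsf u})$ where $C$ is a coalgebra over $k$, $b:C\times C\to k$ is an invertible bilinear form and $T_{\mathsf d},T_{\mathsf u}$ are commuting coalgebra automorphisms of $C$ with respect to $\{b,b^{-1}\}$ such that for all $c,d,e\in C$: (qc.1) $b(c_{(1)},T_{\mathsf u}(d_{(2)}))\,b^{-1}(T_{\mathsf d}(c_{(2)}),d_{(1)})=\epsilon(c)\epsilon(d)$ and $b^{-1}(T_{\mathsf d}(c_{(1)}),d_{(2)})\,b(c_{(2)},T_{\mathsf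 u}(d_{(1)}))=\epsilon(c)\epsilon(d)$; (qc.2) $b(c,d)=b(T_{\mathsf d}(c),T_{\mathsf d}(d))=b(T_{\mathsf u}(c),T_{\mathsf u}(d))$; (qc.3) $b(c_{(1)},d_{(1)})b(c_{(2)},e_{(1)})b(d_{(2)},e_{(2)})=b(c_{(2)},d_{(2)})b(c_{(1)},e_{(2)})b(d_{(1)},e_{(1)})$. A morphism of oriented quantum coalgebras $f:(C,b,T_{\mathsf d},T_{\mathsf u})\to(C',b',T'_{\mathsf d},T'_{\mathsf u})$ is a coalgebra map $f:C\to C'$ with $b(c,d)=b'(f(c),f(d))$ for all $c,d\in C$, $T'_{\mathsf d}\circ f=f\circ T_{\mathsf d}$ and $T'_{\mathsf u}\circ f=f\circ T_{\mathsf u}$. A quantum coalgebra over $k$ is a triple $(C,b,S)$ where $C$ is a coalgebra over $k$, $b:C\times C\to k$ is an invertible bilinear form and $S$ is a linear automorphism of $C$ with $\epsilon\circ S=\epsilon$, $b(S(c_{(1)}),d)b(S(c_{(2)}),e)=b(S(c)_{(2)},d)b(S(c)_{(1)},e)$, $b(d,S(c_{(1)}))b(e,S(c_{(2)}))=b(d,S(c)_{(2)})b(e,S(c)_{(1)})$, $b^{-1}(c,d)=b(S(c),d)$, $b(c,d)=b(S(c),S(d))$, and (qc.3), for all $c,d,e\in C$. In $\mathcal C=C\oplus C^{cop}$ an element $c\in C$ is identified with $c\oplus0$, and $\overline{c\oplus d}=d\oplus c$; thus $\overline c=0\oplus c$. *)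

theory Defs
  imports "HOL-Library.Poly_Mapping" "HOL-Analysis.Product_Vector"
begin

section \<open>Tensor products of vector spaces\<close>

text \<open>
  Vector spaces are given by a scalar multiplication \<open>s :: 'k \<Rightarrow> 'v \<Rightarrow> 'v\<close> with
  \<open>vector_space s\<close>.  The free vector space on a type \<open>'x\<close> is \<open>'x \<Rightarrow>\<^sub>0 'k\<close>, with basis
  \<open>Poly_Mapping.single x 1\<close>.
\<close>

definition free_scale :: "'k::field \<Rightarrow> ('x \<Rightarrow>\<^sub>0 'k) \<Rightarrow> ('x \<Rightarrow>\<^sub>0 'k)" where
  "free_scale a p = Poly_Mapping.map ((*) a) p"

lemma lookup_free_scale [simp]: "Poly_Mapping.lookup (free_scale a p) x = a * Poly_Mapping.lookup p x"
  by (simp add: free_scale_def Poly_Mapping.map.rep_eq when_def)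

interpretation free: vector_space "free_scale :: 'k::field \<Rightarrow> ('x \<Rightarrow>\<^sub>0 'k) \<Rightarrow> ('x \<Rightarrow>\<^sub>0 'k)"
  by unfold_locales
    (auto intro!: poly_mapping_eqI simp: Poly_Mapping.lookup_add algebra_simps)

text \<open>
  The tensor product of \<open>V\<close> and \<open>W\<close> is the quotient of the free vector space on \<open>V \<times> W\<close>
  by the subspace \<open>tensor_rel\<close>; its elements are cosets, so \<open>tensor_class s t p\<close> is the
  tensor \<open>\<Sum> a\<^sub>i (x\<^sub>i \<otimes> y\<^sub>i)\<close> for the formal sum \<open>p = \<Sum> a\<^sub>i (x\<^sub>i, y\<^sub>i)\<close>.
\<close>

definition tensor_rel ::
  "('k::field \<Rightarrow> 'v::ab_group_add \<Rightarrow> 'v) \<Rightarrow> ('k \<Rightarrow> 'w::ab_group_add \<Rightarrow> 'w) \<Rightarrow> ('v \<times> 'w \<Rightarrow>\<^sub>0 'k) set"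
where
  "tensor_rel s t = free.span
     ({Poly_Mapping.single (x + x', y) 1 - Poly_Mapping.single (x, y) 1
         - Poly_Mapping.single (x', y) 1 | x x' y. True}
    \<union> {Poly_Mapping.single (x, y + y') 1 - Poly_Mapping.single (x, y) 1
         - Poly_Mapping.single (x, y') 1 | x y y'. True}
    \<union> {Poly_Mapping.single (s a x, y) 1 - Poly_Mapping.single (x, y) a | a x y. True}
    \<union> {Poly_Mapping.single (x, t a y) 1 - Poly_Mapping.single (x, y) a | a x y. True})"

definition tensor_class ::
  "('k::field \<Rightarrow> 'v::ab_group_add \<Rightarrow> 'v) \<Rightarrow> ('k \<Rightarrow> 'w::ab_group_add \<Rightarrow> 'w)
    \<Rightarrow> ('v \<times> 'w \<Rightarrow>\<^sub>0 'k) \<Rightarrow> ('v \<times> 'w \<Rightarrow>\<^sub>0 'k) set"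
where
  "tensor_class s t p = {q. q - p \<in> tensor_rel s t}"

definition tensor_space ::
  "('k::field \<Rightarrow> 'v::ab_group_add \<Rightarrow> 'v) \<Rightarrow> ('k \<Rightarrow> 'w::ab_group_add \<Rightarrow> 'w)
    \<Rightarrow> ('v \<times> 'w \<Rightarrow>\<^sub>0 'k) set set"
where
  "tensor_space s t = range (tensor_class s t)"

definition tensor_rep :: "('x \<Rightarrow>\<^sub>0 'k::field) set \<Rightarrow> ('x \<Rightarrow>\<^sub>0 'k)" where
  "tensor_rep X = (SOME p. p \<in> X)"

definition tensor_add ::
  "('k::field \<Rightarrow> 'v::ab_group_add \<Rightarrow> 'v) \<Rightarrow> ('k \<Rightarrow> 'w::ab_group_add \<Rightarrow> 'w)
    \<Rightarrow> ('v \<times> 'w \<Rightarrow>\<^sub>0 'k) set \<Rightarrow> ('v \<times> 'w \<Rightarrow>\<^sub>0 'k) set \<Rightarrow> ('v \<times> 'w \<Rightarrow>\<^sub>0 'k) set"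
where
  "tensor_add s t X Y = tensor_class s t (tensor_rep X + tensor_rep Y)"

definition tensor_scale ::
  "('k::field \<Rightarrow> 'v::ab_group_add \<Rightarrow> 'v) \<Rightarrow> ('k \<Rightarrow> 'w::ab_group_add \<Rightarrow> 'w)
    \<Rightarrow> 'k \<Rightarrow> ('v \<times> 'w \<Rightarrow>\<^sub>0 'k) set \<Rightarrow> ('v \<times> 'w \<Rightarrow>\<^sub>0 'k) set"
where
  "tensor_scale s t a X = tensor_class s t (free_scale a (tensor_rep X))"

definition bilinear_map ::
  "('k::field \<Rightarrow> 'v::ab_group_add \<Rightarrow> 'v) \<Rightarrow> ('k \<Rightarrow> 'w::ab_group_add \<Rightarrow> 'w)
    \<Rightarrow> ('k \<Rightarrow> 'u::ab_group_add \<Rightarrow> 'u) \<Rightarrow> ('v \<Rightarrow> 'w \<Rightarrow> 'u) \<Rightarrow> bool"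
where
  "bilinear_map s t r f \<longleftrightarrow>
     (\<forall>x. Vector_Spaces.linear t r (\<lambda>y. f x y)) \<and> (\<forall>y. Vector_Spaces.linear s r (\<lambda>x. f x y))"

definition free_extend ::
  "('k::field \<Rightarrow> 'u::ab_group_add \<Rightarrow> 'u) \<Rightarrow> ('x \<Rightarrow> 'u) \<Rightarrow> ('x \<Rightarrow>\<^sub>0 'k) \<Rightarrow> 'u" where
  "free_extend r f p = (\<Sum>x\<in>Poly_Mapping.keys p. r (Poly_Mapping.lookup p x) (f x))"

text \<open>
  For a bilinear map \<open>f\<close> this is the value at a tensor of the linear map on \<open>V \<otimes> W\<close>
  induced by \<open>f\<close>; it does not depend on the representative, see \<open>tensor_lift_class\<close> below.
  Sweedler sums are written with it: \<open>f(c\<^sub>(\<^sub>1\<^sub>), c\<^sub>(\<^sub>2\<^sub>))\<close> is \<open>tensor_lift r f (\<Delta> c)\<close>.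
\<close>

definition tensor_lift ::
  "('k::field \<Rightarrow> 'u::ab_group_add \<Rightarrow> 'u) \<Rightarrow> ('v \<Rightarrow> 'w \<Rightarrow> 'u) \<Rightarrow> ('v \<times> 'w \<Rightarrow>\<^sub>0 'k) set \<Rightarrow> 'u"
where
  "tensor_lift r f X = free_extend r (\<lambda>(x, y). f x y) (tensor_rep X)"

lemma free_extend_superset:
  assumes "vector_space r" "finite A" "Poly_Mapping.keys p \<subseteq> A"
  shows "free_extend r f p = (\<Sum>x\<in>A. r (Poly_Mapping.lookup p x) (f x))"
proof -
  interpret vector_space r by fact
  show ?thesis
    unfolding free_extend_def
    by (rule sum.mono_neutral_left) (use assms in \<open>auto simp: in_keys_iff\<close>)
qed

lemma linear_free_extend:
  assumes "vector_space r"
  shows "Vector_Spaces.linear free_scale r (free_extend r f)"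
proof -
  interpret vector_space r by fact
  show ?thesis
  proof (intro Vector_Spaces.linear_iff[THEN iffD2] conjI allI)
    show "vector_space (free_scale :: 'a \<Rightarrow> ('c \<Rightarrow>\<^sub>0 'a) \<Rightarrow> _)" by unfold_locales
    show "vector_space r" by fact
    fix p q :: "'c \<Rightarrow>\<^sub>0 'a"
    show "free_extend r f (p + q) = free_extend r f p + free_extend r f q"
      using Poly_Mapping.keys_add[of p q]
      by (simp add: free_extend_superset[OF assms, of "Poly_Mapping.keys p \<union> Poly_Mapping.keys q"] Poly_Mapping.lookup_add
          scale_left_distrib sum.distrib)
  next
    fix a and p :: "'c \<Rightarrow>\<^sub>0 'a"
    have "Poly_Mapping.keys (free_scale a p) \<subseteq> Poly_Mapping.keys p" by (auto simp: in_keys_iff)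
    then show "free_extend r f (free_scale a p) = r a (free_extend r f p)"
      by (simp add: free_extend_superset[OF assms, of "Poly_Mapping.keys p"] scale_sum_right)
  qed
qed

lemma tensor_lift_class:
  assumes f: "bilinear_map s t r f"
  shows "tensor_lift r f (tensor_class s t p) = free_extend r (\<lambda>(x, y). f x y) p"
proof -
  let ?F = "free_extend r (\<lambda>(x, y). f x y)"
  have l2: "Vector_Spaces.linear t r (f x)" for x
    using f by (simp add: bilinear_map_def)
  have l1: "Vector_Spaces.linear s r (\<lambda>x. f x y)" for y
    using f by (simp add: bilinear_map_def)
  have r: "vector_space r" using l2[of undefined] by (simp add: Vector_Spaces.linear_iff)
  interpret r: vector_space r by fact
  interpret F: Vector_Spaces.linear free_scale r ?F by (rule linear_free_extend[OF r])
  have single: "?F (Poly_Mapping.single z a) = r a (f (fst z) (snd z))" for z a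
    by (simp add: free_extend_superset[OF r, of "{z}"] split_beta)
  have zero: "?F z = 0" if "z \<in> tensor_rel s t" for z
    using that unfolding tensor_rel_def
  proof (induction rule: free.span_induct)
    case base
    show ?case by (auto simp: free.subspace_def F.add F.scale)
  next
    case (step x)
    then show ?case
      using l1 l2 by (auto simp: F.diff single Vector_Spaces.linear_iff)
  qed
  have "p \<in> tensor_class s t p"
    by (simp add: tensor_class_def tensor_rel_def free.span_zero)
  then have "tensor_rep (tensor_class s t p) \<in> tensor_class s t p"
    unfolding tensor_rep_def by (rule someI)
  then have "?F (tensor_rep (tensor_class s t p) - p) = 0"
    by (intro zero) (simp add: tensor_class_def)
  then show ?thesis by (simp add: tensor_lift_def F.diff)
qed

definition tensor_map ::
  "('k::field \<Rightarrow> 'v'::ab_group_add \<Rightarrow> 'v') \<Rightarrow> ('k \<Rightarrow> 'w'::ab_group_add \<Rightarrow> 'w')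
    \<Rightarrow> ('v \<Rightarrow> 'v') \<Rightarrow> ('w \<Rightarrow> 'w') \<Rightarrow> ('v \<times> 'w \<Rightarrow>\<^sub>0 'k) set \<Rightarrow> ('v' \<times> 'w' \<Rightarrow>\<^sub>0 'k) set"
where
  "tensor_map s t f g X =
     tensor_class s t (tensor_lift free_scale (\<lambda>x y. Poly_Mapping.single (f x, g y) 1) X)"

definition tensor_swap ::
  "('k::field \<Rightarrow> 'v::ab_group_add \<Rightarrow> 'v) \<Rightarrow> ('k \<Rightarrow> 'w::ab_group_add \<Rightarrow> 'w)
    \<Rightarrow> ('v \<times> 'w \<Rightarrow>\<^sub>0 'k) set \<Rightarrow> ('w \<times> 'v \<Rightarrow>\<^sub>0 'k) set"
where
  "tensor_swap s t X =
     tensor_class t s (tensor_lift free_scale (\<lambda>x y. Poly_Mapping.single (y, x) 1) X)"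

text \<open>\<open>V \<otimes> V \<otimes> V\<close>, as the quotient of the free vector space on \<open>V \<times> V \<times> V\<close> by trilinearity.\<close>

definition tensor3_rel ::
  "('k::field \<Rightarrow> 'v::ab_group_add \<Rightarrow> 'v) \<Rightarrow> ('v \<times> 'v \<times> 'v \<Rightarrow>\<^sub>0 'k) set"
where
  "tensor3_rel s = free.span
     ({Poly_Mapping.single (x + x', y, z) 1 - Poly_Mapping.single (x, y, z) 1
         - Poly_Mapping.single (x', y, z) 1 | x x' y z. True}
    \<union> {Poly_Mapping.single (x, y + y', z) 1 - Poly_Mapping.single (x, y, z) 1
         - Poly_Mapping.single (x, y', z) 1 | x y y' z. True}
    \<union> {Poly_Mapping.single (x, y, z + z') 1 - Poly_Mapping.single (x, y, z) 1
         - Poly_Mapping.single (x, y, z') 1 | x y z z'. True}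
    \<union> {Poly_Mapping.single (s a x, y, z) 1 - Poly_Mapping.single (x, y, z) a | a x y z. True}
    \<union> {Poly_Mapping.single (x, s a y, z) 1 - Poly_Mapping.single (x, y, z) a | a x y z. True}
    \<union> {Poly_Mapping.single (x, y, s a z) 1 - Poly_Mapping.single (x, y, z) a | a x y z. True})"

definition tensor3_class ::
  "('k::field \<Rightarrow> 'v::ab_group_add \<Rightarrow> 'v) \<Rightarrow> ('v \<times> 'v \<times> 'v \<Rightarrow>\<^sub>0 'k)
    \<Rightarrow> ('v \<times> 'v \<times> 'v \<Rightarrow>\<^sub>0 'k) set"
where
  "tensor3_class s p = {q. q - p \<in> tensor3_rel s}"


section \<open>Coalgebras\<close>

record (overloaded) ('k::zero, 'c) coalgebra =
  smult :: "'k \<Rightarrow> 'c \<Rightarrow> 'c"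
  comult :: "'c \<Rightarrow> ('c \<times> 'c \<Rightarrow>\<^sub>0 'k) set"
  counit :: "'c \<Rightarrow> 'k"

definition comult_left ::
  "('k::field, 'c::ab_group_add) coalgebra \<Rightarrow> ('c \<times> 'c \<Rightarrow>\<^sub>0 'k) set
    \<Rightarrow> ('c \<times> 'c \<times> 'c \<Rightarrow>\<^sub>0 'k) set"
  \<comment> \<open>\<open>\<Delta> \<otimes> id\<close>\<close>
where
  "comult_left C X = tensor3_class (smult C)
     (tensor_lift free_scale
       (\<lambda>x y. tensor_lift free_scale (\<lambda>u v. Poly_Mapping.single (u, v, y) 1) (comult C x)) X)"

definition comult_right ::
  "('k::field, 'c::ab_group_add) coalgebra \<Rightarrow> ('c \<times> 'c \<Rightarrow>\<^sub>0 'k) set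
    \<Rightarrow> ('c \<times> 'c \<times> 'c \<Rightarrow>\<^sub>0 'k) set"
  \<comment> \<open>\<open>id \<otimes> \<Delta>\<close>\<close>
where
  "comult_right C X = tensor3_class (smult C)
     (tensor_lift free_scale
       (\<lambda>x y. tensor_lift free_scale (\<lambda>u v. Poly_Mapping.single (x, u, v) 1) (comult C y)) X)"

definition is_coalgebra :: "('k::field, 'c::ab_group_add) coalgebra \<Rightarrow> bool" where
  "is_coalgebra C \<longleftrightarrow>
     vector_space (smult C) \<and>
     (\<forall>c. comult C c \<in> tensor_space (smult C) (smult C)) \<and>
     (\<forall>c d. comult C (c + d) = tensor_add (smult C) (smult C) (comult C c) (comult C d)) \<and>
     (\<forall>a c. comult C (smult C a c) = tensor_scale (smult C) (smult C) a (comult C c)) \<and>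
     Vector_Spaces.linear (smult C) (*) (counit C) \<and>
     (\<forall>c. comult_left C (comult C c) = comult_right C (comult C c)) \<and>
     (\<forall>c. tensor_lift (smult C) (\<lambda>x y. smult C (counit C x) y) (comult C c) = c) \<and>
     (\<forall>c. tensor_lift (smult C) (\<lambda>x y. smult C (counit C y) x) (comult C c) = c)"

definition is_coalgebra_map ::
  "('k::field, 'c::ab_group_add) coalgebra \<Rightarrow> ('k, 'd::ab_group_add) coalgebra
    \<Rightarrow> ('c \<Rightarrow> 'd) \<Rightarrow> bool"
where
  "is_coalgebra_map C D f \<longleftrightarrow>
     Vector_Spaces.linear (smult C) (smult D) f \<and>
     (\<forall>c. comult D (f c) = tensor_map (smult D) (smult D) f f (comult C c)) \<and>
     (\<forall>c. counit D (f c) = counit C c)"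

definition cop :: "('k::field, 'c::ab_group_add) coalgebra \<Rightarrow> ('k, 'c) coalgebra" where
  "cop C = C\<lparr>comult := (\<lambda>c. tensor_swap (smult C) (smult C) (comult C c))\<rparr>"

definition coalgebra_sum ::
  "('k::field, 'c::ab_group_add) coalgebra \<Rightarrow> ('k, 'd::ab_group_add) coalgebra
    \<Rightarrow> ('k, 'c \<times> 'd) coalgebra"
where
  "coalgebra_sum C D =
     (let s = module_prod.scale (smult C) (smult D) in
      \<lparr>smult = s,
       comult = (\<lambda>(c, d). tensor_add s s
                   (tensor_map s s (\<lambda>x. (x, 0)) (\<lambda>x. (x, 0)) (comult C c))
                   (tensor_map s s (\<lambda>y. (0, y)) (\<lambda>y. (0, y)) (comult D d))),
       counit = (\<lambda>(c, d). counit C c + counit D d)\<rparr>)"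


section \<open>Quantum coalgebras and oriented quantum coalgebras\<close>

text \<open>\<open>sweedler C c (\<lambda>c1 c2. f c1 c2)\<close> is the scalar \<open>f(c\<^sub>(\<^sub>1\<^sub>), c\<^sub>(\<^sub>2\<^sub>))\<close>, for bilinear \<open>f\<close>.\<close>

definition sweedler ::
  "('k::field, 'c::ab_group_add) coalgebra \<Rightarrow> 'c \<Rightarrow> ('c \<Rightarrow> 'c \<Rightarrow> 'k) \<Rightarrow> 'k"
where
  "sweedler C c f = tensor_lift (*) f (comult C c)"

definition bilinear_form ::
  "('k::field, 'c::ab_group_add) coalgebra \<Rightarrow> ('c \<Rightarrow> 'c \<Rightarrow> 'k) \<Rightarrow> bool"
where
  "bilinear_form C b \<longleftrightarrow> bilinear_map (smult C) (smult C) (*) b"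

definition is_form_inverse ::
  "('k::field, 'c::ab_group_add) coalgebra \<Rightarrow> ('c \<Rightarrow> 'c \<Rightarrow> 'k) \<Rightarrow> ('c \<Rightarrow> 'c \<Rightarrow> 'k) \<Rightarrow> bool"
where
  "is_form_inverse C b b' \<longleftrightarrow>
     bilinear_form C b' \<and>
     (\<forall>c d. sweedler C c (\<lambda>c1 c2. sweedler C d (\<lambda>d1 d2. b' c1 d1 * b c2 d2))
              = counit C c * counit C d) \<and>
     (\<forall>c d. sweedler C c (\<lambda>c1 c2. sweedler C d (\<lambda>d1 d2. b c1 d1 * b' c2 d2))
              = counit C c * counit C d)"

definition invertible_form ::
  "('k::field, 'c::ab_group_add) coalgebra \<Rightarrow> ('c \<Rightarrow> 'c \<Rightarrow> 'k) \<Rightarrow> bool"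
where
  "invertible_form C b \<longleftrightarrow> bilinear_form C b \<and> (\<exists>b'. is_form_inverse C b b')"

text \<open>Inverses are unique, being inverses in the convolution algebra of bilinear forms.\<close>

definition form_inverse ::
  "('k::field, 'c::ab_group_add) coalgebra \<Rightarrow> ('c \<Rightarrow> 'c \<Rightarrow> 'k) \<Rightarrow> 'c \<Rightarrow> 'c \<Rightarrow> 'k"
where
  "form_inverse C b = (THE b'. is_form_inverse C b b')"

definition linear_automorphism ::
  "('k::field, 'c::ab_group_add) coalgebra \<Rightarrow> ('c \<Rightarrow> 'c) \<Rightarrow> bool"
where
  "linear_automorphism C T \<longleftrightarrow> Vector_Spaces.linear (smult C) (smult C) T \<and> bij T"

definition coalgebra_automorphism_wrt ::
  "('k::field, 'c::ab_group_add) coalgebra \<Rightarrow> ('c \<Rightarrow> 'c \<Rightarrow> 'k) set \<Rightarrow> ('c \<Rightarrow> 'c) \<Rightarrow> bool"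
where
  "coalgebra_automorphism_wrt C \<S> T \<longleftrightarrow>
     linear_automorphism C T \<and>
     counit C \<circ> T = counit C \<and>
     (\<forall>b\<in>\<S>. \<forall>b'\<in>\<S>. \<forall>c d e.
        sweedler C c (\<lambda>c1 c2. b (T c1) d * b' (T c2) e)
          = sweedler C (T c) (\<lambda>x1 x2. b x1 d * b' x2 e) \<and>
        sweedler C c (\<lambda>c1 c2. b d (T c1) * b' e (T c2))
          = sweedler C (T c) (\<lambda>x1 x2. b d x1 * b' e x2))"

definition qc3 ::
  "('k::field, 'c::ab_group_add) coalgebra \<Rightarrow> ('c \<Rightarrow> 'c \<Rightarrow> 'k) \<Rightarrow> bool"
where
  "qc3 C b \<longleftrightarrow> (\<forall>c d e.
     sweedler C c (\<lambda>c1 c2. sweedler C d (\<lambda>d1 d2. sweedler C e (\<lambda>e1 e2.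
       b c1 d1 * b c2 e1 * b d2 e2)))
     = sweedler C c (\<lambda>c1 c2. sweedler C d (\<lambda>d1 d2. sweedler C e (\<lambda>e1 e2.
       b c2 d2 * b c1 e2 * b d1 e1))))"

definition oriented_quantum_coalgebra ::
  "('k::field, 'c::ab_group_add) coalgebra \<Rightarrow> ('c \<Rightarrow> 'c \<Rightarrow> 'k)
    \<Rightarrow> ('c \<Rightarrow> 'c) \<Rightarrow> ('c \<Rightarrow> 'c) \<Rightarrow> bool"
where
  "oriented_quantum_coalgebra C b Td Tu \<longleftrightarrow>
     is_coalgebra C \<and>
     invertible_form C b \<and>
     coalgebra_automorphism_wrt C {b, form_inverse C b} Td \<and>
     coalgebra_automorphism_wrt C {b, form_inverse C b} Tu \<and>
     Td \<circ> Tu = Tu \<circ> Td \<and>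
     (\<forall>c d. sweedler C c (\<lambda>c1 c2. sweedler C d (\<lambda>d1 d2.
              b c1 (Tu d2) * form_inverse C b (Td c2) d1)) = counit C c * counit C d) \<and>
     (\<forall>c d. sweedler C c (\<lambda>c1 c2. sweedler C d (\<lambda>d1 d2.
              form_inverse C b (Td c1) d2 * b c2 (Tu d1))) = counit C c * counit C d) \<and>
     (\<forall>c d. b c d = b (Td c) (Td d) \<and> b c d = b (Tu c) (Tu d)) \<and>
     qc3 C b"

definition oriented_quantum_coalgebra_morphism ::
  "('k::field, 'c::ab_group_add) coalgebra \<Rightarrow> ('c \<Rightarrow> 'c \<Rightarrow> 'k) \<Rightarrow> ('c \<Rightarrow> 'c) \<Rightarrow> ('c \<Rightarrow> 'c)
    \<Rightarrow> ('k, 'd::ab_group_add) coalgebra \<Rightarrow> ('d \<Rightarrow> 'd \<Rightarrow> 'k) \<Rightarrow> ('d \<Rightarrow> 'd) \<Rightarrow> ('d \<Rightarrow> 'd)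
    \<Rightarrow> ('c \<Rightarrow> 'd) \<Rightarrow> bool"
where
  "oriented_quantum_coalgebra_morphism C b Td Tu C' b' Td' Tu' f \<longleftrightarrow>
     oriented_quantum_coalgebra C b Td Tu \<and>
     oriented_quantum_coalgebra C' b' Td' Tu' \<and>
     is_coalgebra_map C C' f \<and>
     (\<forall>c d. b c d = b' (f c) (f d)) \<and>
     Td' \<circ> f = f \<circ> Td \<and>
     Tu' \<circ> f = f \<circ> Tu"

definition quantum_coalgebra ::
  "('k::field, 'c::ab_group_add) coalgebra \<Rightarrow> ('c \<Rightarrow> 'c \<Rightarrow> 'k) \<Rightarrow> ('c \<Rightarrow> 'c) \<Rightarrow> bool"
where
  "quantum_coalgebra C b S \<longleftrightarrow>
     is_coalgebra C \<and>
     invertible_form C b \<and>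
     linear_automorphism C S \<and>
     counit C \<circ> S = counit C \<and>
     (\<forall>c d e. sweedler C c (\<lambda>c1 c2. b (S c1) d * b (S c2) e)
                = sweedler C (S c) (\<lambda>x1 x2. b x2 d * b x1 e)) \<and>
     (\<forall>c d e. sweedler C c (\<lambda>c1 c2. b d (S c1) * b e (S c2))
                = sweedler C (S c) (\<lambda>x1 x2. b d x2 * b e x1)) \<and>
     (\<forall>c d. form_inverse C b c d = b (S c) d) \<and>
     (\<forall>c d. b c d = b (S c) (S d)) \<and>
     qc3 C b"


section \<open>The data on the direct sum of \<open>C\<close> and its co-opposite\<close>

definition double_form ::
  "('k::field, 'c::ab_group_add) coalgebra \<Rightarrow> ('c \<Rightarrow> 'c \<Rightarrow> 'k) \<Rightarrow> ('c \<Rightarrow> 'c) \<Rightarrow> ('c \<Rightarrow> 'c)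
    \<Rightarrow> 'c \<times> 'c \<Rightarrow> 'c \<times> 'c \<Rightarrow> 'k"
where
  "double_form C b Td Tu = (\<lambda>(c, c') (d, d').
     b c d + b c' d' + form_inverse C b c' d + form_inverse C b c ((inv Td \<circ> inv Tu) d'))"

text \<open>
  \<open>double_form\<close> is the only biadditive form with the prescribed values on the two summands
  \<open>c = (c, 0)\<close> and \<open>\<bar>c = (0, c)\<close>.
\<close>

lemma double_form_unique:
  assumes add1: "\<And>x x' y. \<beta> (x + x') y = \<beta> x y + \<beta> x' y"
    and add2: "\<And>x y y'. \<beta> x (y + y') = \<beta> x y + \<beta> x y'"
    and "\<And>c d. \<beta> (c, 0) (d, 0) = b c d"
    and "\<And>c d. \<beta> (0, c) (0, d) = b c d"
    and "\<And>c d. \<beta> (0, c) (d, 0) = form_inverse C b c d"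
    and "\<And>c d. \<beta> (c, 0) (0, d) = form_inverse C b c ((inv Td \<circ> inv Tu) d)"
  shows "\<beta> = double_form C b Td Tu"
proof (intro ext, clarify)
  fix c c' d d'
  have "\<beta> (c, c') (d, d') = \<beta> ((c, 0) + (0, c')) ((d, 0) + (0, d'))" by simp
  then show "\<beta> (c, c') (d, d') = double_form C b Td Tu (c, c') (d, d')"
    by (simp only: add1 add2 assms(3-6)) (simp add: double_form_def)
qed

definition double_antipode :: "('c \<Rightarrow> 'c) \<Rightarrow> ('c \<Rightarrow> 'c) \<Rightarrow> 'c \<times> 'c \<Rightarrow> 'c \<times> 'c" where
  "double_antipode Td Tu = (\<lambda>(c, d). ((inv Td \<circ> inv Tu) d, c))"

end

theory Submission
  imports Defs
begin

text \<open>
  Functionals separate points over a field, so every identity between tensors reduces to scalar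
  Sweedler identities with multilinear forms. On the summands of \<open>C \<oplus> C\<^sup>c\<^sup>o\<^sup>p\<close> all
  conditions become identities in convolution algebras of forms. With
  \<open>E = T\<^sub>d\<inverse> T\<^sub>u\<inverse>\<close>, condition (qc.1) says that \<open>b\<close> and \<open>b\<inverse> \<circ> (id \<times> E)\<close> are inverse
  forms on \<open>C \<times> C\<^sup>c\<^sup>o\<^sup>p\<close>. Condition (qc.3) is a Yang--Baxter identity
  \<open>b\<^sub>1\<^sub>2 b\<^sub>1\<^sub>3 b\<^sub>2\<^sub>3 = b\<^sub>2\<^sub>3 b\<^sub>1\<^sub>3 b\<^sub>1\<^sub>2\<close>; multiplying it by the inverse of one factor gives an
  identity of the same shape in which two of the three coproducts are reversed, and the eight
  cases of (qc.3) for \<open>\<beta>\<close> arise by iterating this.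
\<close>

section \<open>Linear functionals and tensors\<close>

text \<open>The obstacle is that \<open>Td\<close> and \<open>Tu\<close> need not be coalgebra maps:
  the axioms let such a map pass through a coproduct only inside a product of two forms taken from b
  and its inverse, with both halves in the same argument position. Every step that moves such a map
  therefore first arranges it on both halves, and invariance (qc.2) is the tool for that. In the
  double two conditions trade places: on mixed summands invertibility of \<open>\<beta>\<close> is
  (qc.1) for C, and (qc.1) for \<open>\<beta>\<close> is invertibility of b. Coproducts enter
  through their Sweedler sums, as operators on functions of two variables, so reversing a coproduct
  means exchanging two arguments, and the convolution and Yang-Baxter arguments are made once for
  all mixtures of C and C^cop. A Sweedler sum is a finite sum over one chosen representative, so two
  of them always commute; bilinearity has to be checked where one coproduct is replaced by another,
  as for the co-opposite and the direct sum.\<close>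

abbreviation functional :: "('k::field \<Rightarrow> 'v::ab_group_add \<Rightarrow> 'v) \<Rightarrow> ('v \<Rightarrow> 'k) \<Rightarrow> bool" where
  "functional s \<equiv> Vector_Spaces.linear s (*)"

lemma vector_space_times: "vector_space ((*) :: 'k::field \<Rightarrow> 'k \<Rightarrow> 'k)"
  by unfold_locales (auto simp: algebra_simps)

lemma vector_space_free: "vector_space (free_scale :: 'k::field \<Rightarrow> ('x \<Rightarrow>\<^sub>0 'k) \<Rightarrow> _)"
  by unfold_locales

lemma functional_iff:
  "functional s f \<longleftrightarrow>
     vector_space s \<and> (\<forall>x y. f (x + y) = f x + f y) \<and> (\<forall>a x. f (s a x) = a * f x)"
  using vector_space_times by (auto simp: Vector_Spaces.linear_iff)

lemma linear_zero: "Vector_Spaces.linear s t f \<Longrightarrow> f 0 = 0"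
  unfolding Vector_Spaces.linear_iff by (metis add_0 add_cancel_right_right)

lemma linear_diff: "Vector_Spaces.linear s t f \<Longrightarrow> f (x - y) = f x - f y"
  unfolding Vector_Spaces.linear_iff by (metis add_diff_cancel diff_add_cancel)

lemma linear_sum:
  assumes "Vector_Spaces.linear s t f"
  shows "f (sum g A) = (\<Sum>x\<in>A. f (g x))"
proof -
  have "f (sum g A) = sum (f \<circ> g) A"
    using assms linear_zero[OF assms] unfolding Vector_Spaces.linear_iff
    by (induction A rule: infinite_finite_induct) auto
  then show ?thesis by simp
qed

lemma linear_compose:
  "Vector_Spaces.linear t r T \<Longrightarrow> Vector_Spaces.linear p t U \<Longrightarrow> Vector_Spaces.linear p r (\<lambda>x. T (U x))"
  by (auto simp: Vector_Spaces.linear_iff)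

text \<open>A basis of the span of G stays independent after adding p, so a functional may be
  prescribed as 1 at p and 0 on that basis.\<close>

lemma functional_separates:
  assumes "vector_space s" and "p \<notin> module.span s G"
  obtains \<phi> where "functional s \<phi>" "\<And>x. x \<in> G \<Longrightarrow> \<phi> x = 0" "\<phi> p \<noteq> 0"
proof -
  interpret vs: vector_space s by fact
  interpret vp: vector_space_pair s "(*)"
    by (simp add: assms(1) vector_space_pair_def vector_space_times)
  obtain B where B: "B \<subseteq> vs.span G" "vs.independent B" "vs.span G \<subseteq> vs.span B"
    using vs.maximal_independent_subset by blast
  have span: "vs.span B \<subseteq> vs.span G"
    using B(1) vs.span_minimal vs.subspace_span by blast
  then have "vs.independent (insert p B)"
    using B(2) assms(2) by (auto simp: vs.independent_insert)
  then obtain \<phi> where \<phi>: "functional s \<phi>"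
      "\<And>x. x \<in> insert p B \<Longrightarrow> \<phi> x = (if x = p then 1 else 0)"
    using vp.linear_independent_extend[of "insert p B" "\<lambda>x. if x = p then 1 else 0"] by blast
  have "p \<notin> B" using B(1) assms(2) by blast
  interpret \<phi>: Vector_Spaces.linear s "(*)" \<phi> by (rule \<phi>(1))
  have "\<phi> x = 0" if "x \<in> G" for x
  proof -
    have "x \<in> vs.span B" using that B(3) vs.span_base by blast
    then show ?thesis
    proof (induction rule: vs.span_induct)
      case base
      show ?case by (auto simp: vs.subspace_def \<phi>.add \<phi>.scale \<phi>.zero)
    next
      case (step x)
      then show ?case using \<phi>(2) \<open>p \<notin> B\<close> by auto
    qed
  qed
  with \<phi> show ?thesis by (intro that[of \<phi>]) auto
qed

lemma functionals_eqI:
  assumes "vector_space s" and "\<And>\<phi>. functional s \<phi> \<Longrightarrow> \<phi> x = \<phi> y"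
  shows "x = y"
proof (rule ccontr)
  interpret vs: vector_space s by fact
  assume "x \<noteq> y"
  then have "x - y \<notin> vs.span {}" by simp
  then obtain \<phi> where "functional s \<phi>" "\<phi> (x - y) \<noteq> 0"
    using functional_separates[OF assms(1)] by metis
  then show False using assms(2) linear_diff by fastforce
qed

lemma free_extend_single [simp]:
  "free_extend (*) f (Poly_Mapping.single z (a :: 'k::field)) = a * f z"
  by (simp add: free_extend_superset[OF vector_space_times, of "{z}"])

lemma functional_free_extend: "functional free_scale (free_extend (*) f)"
  by (rule linear_free_extend[OF vector_space_times])

lemma free_extend_functional:
  assumes "functional free_scale \<phi>"
  shows "free_extend (*) (\<lambda>z. \<phi> (Poly_Mapping.single z 1)) p = \<phi> p"
proof -
  have single: "\<phi> (Poly_Mapping.single z a) = a * \<phi> (Poly_Mapping.single z 1)" for z a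
  proof -
    have "Poly_Mapping.single z a = free_scale a (Poly_Mapping.single z 1)"
      by (rule poly_mapping_eqI) (simp add: lookup_single when_def)
    then show ?thesis using assms by (simp add: functional_iff)
  qed
  have "p = (\<Sum>z\<in>Poly_Mapping.keys p. Poly_Mapping.single z (Poly_Mapping.lookup p z))"
    by (rule poly_mapping_eqI) (simp add: lookup_sum lookup_single when_def in_keys_iff)
  then have "\<phi> p = (\<Sum>z\<in>Poly_Mapping.keys p. \<phi> (Poly_Mapping.single z (Poly_Mapping.lookup p z)))"
    by (metis linear_sum[OF assms])
  then show ?thesis by (subst (asm) single) (simp add: free_extend_def)
qed

text \<open>Functionals on the free space are the free extensions of functions on the basis type, so
  quantifying over such functions suffices to separate p from the span.\<close>

lemma free_span_iff:
  "p \<in> free.span G \<longleftrightarrow>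
     (\<forall>f. (\<forall>q\<in>G. free_extend (*) f q = 0) \<longrightarrow> free_extend (*) f p = 0)"
proof
  assume p: "p \<in> free.span G"
  show "\<forall>f. (\<forall>q\<in>G. free_extend (*) f q = 0) \<longrightarrow> free_extend (*) f p = 0"
  proof (intro allI impI)
    fix f :: "'a \<Rightarrow> 'b"
    assume f: "\<forall>q\<in>G. free_extend (*) f q = 0"
    interpret F: Vector_Spaces.linear free_scale "(*)" "free_extend (*) f"
      by (rule functional_free_extend)
    show "free_extend (*) f p = 0"
      using p
    proof (induction rule: free.span_induct)
      case base
      show ?case by (auto simp: free.subspace_def F.add F.scale F.zero)
    next
      case (step x)
      then show ?case using f by auto
    qed
  qed
next
  assume *: "\<forall>f. (\<forall>q\<in>G. free_extend (*) f q = 0) \<longrightarrow> free_extend (*) f p = 0"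
  show "p \<in> free.span G"
  proof (rule ccontr)
    assume "p \<notin> free.span G"
    then obtain \<phi> where "functional free_scale \<phi>" "\<And>x. x \<in> G \<Longrightarrow> \<phi> x = 0" "\<phi> p \<noteq> 0"
      using functional_separates[OF vector_space_free] by metis
    then show False using * free_extend_functional by metis
  qed
qed

lemma free_span_coset_eq_iff:
  "{r. r - p \<in> free.span G} = {r. r - q \<in> free.span G} \<longleftrightarrow>
     (\<forall>f. (\<forall>z\<in>G. free_extend (*) f z = 0) \<longrightarrow> free_extend (*) f p = free_extend (*) f q)"
proof -
  have "{r. r - p \<in> free.span G} = {r. r - q \<in> free.span G} \<longleftrightarrow> p - q \<in> free.span G"
  proof
    assume "{r. r - p \<in> free.span G} = {r. r - q \<in> free.span G}"
    moreover have "p - p \<in> free.span G" using free.span_zero by simp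
    ultimately show "p - q \<in> free.span G" by blast
  next
    assume pq: "p - q \<in> free.span G"
    have "r - p \<in> free.span G \<longleftrightarrow> r - q \<in> free.span G" for r
      using free.span_add[OF pq, of "r - p"] free.span_diff[of "r - q" G "p - q", OF _ pq]
      by (auto simp: algebra_simps)
    then show "{r. r - p \<in> free.span G} = {r. r - q \<in> free.span G}" by blast
  qed
  also have "\<dots> \<longleftrightarrow>
      (\<forall>f. (\<forall>z\<in>G. free_extend (*) f z = 0) \<longrightarrow> free_extend (*) f p = free_extend (*) f q)"
    unfolding free_span_iff linear_diff[OF functional_free_extend] by simp
  finally show ?thesis .
qed

definition trilinear_form :: "('k::field \<Rightarrow> 'v::ab_group_add \<Rightarrow> 'v) \<Rightarrow> ('v \<Rightarrow> 'v \<Rightarrow> 'v \<Rightarrow> 'k) \<Rightarrow> bool"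
  where "trilinear_form s f \<longleftrightarrow>
    (\<forall>y z. functional s (\<lambda>x. f x y z)) \<and> (\<forall>x z. functional s (\<lambda>y. f x y z)) \<and>
    (\<forall>x y. functional s (\<lambda>z. f x y z))"

lemma bilinear_map_times_iff:
  "bilinear_map s t (*) f \<longleftrightarrow> (\<forall>x. functional t (\<lambda>y. f x y)) \<and> (\<forall>y. functional s (\<lambda>x. f x y))"
  by (simp add: bilinear_map_def)

lemma ball_Collect_ex:
  "(\<forall>z\<in>{f x y w |x y w. True}. P z) \<longleftrightarrow> (\<forall>x y w. P (f x y w))"
  "(\<forall>z\<in>{g x y w v |x y w v. True}. P z) \<longleftrightarrow> (\<forall>x y w v. P (g x y w v))"
  by blast+

text \<open>The free extension of f kills the four families of generators of
  \<open>tensor_rel\<close> exactly when f is additive and homogeneous in each argument.\<close>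

lemma tensor_class_eq_iff:
  assumes "vector_space s" "vector_space t"
  shows "tensor_class s t p = tensor_class s t q \<longleftrightarrow>
    (\<forall>f. bilinear_map s t (*) f \<longrightarrow>
       free_extend (*) (\<lambda>(x, y). f x y) p = free_extend (*) (\<lambda>(x, y). f x y) q)"
proof -
  have *: "(\<forall>h :: 'b \<times> 'c \<Rightarrow> 'a. P h) \<longleftrightarrow> (\<forall>f. P (\<lambda>(x, y). f x y))" for P
    by (metis case_prod_curry)
  show ?thesis
    unfolding tensor_class_def tensor_rel_def free_span_coset_eq_iff * ball_Un ball_Collect_ex
    using assms
    by (intro iff_allI imp_cong refl)
      (simp add: bilinear_map_times_iff functional_iff linear_diff[OF functional_free_extend];
        simp add: diff_eq_eq add.commute; blast)
qed

lemma tensor3_class_eq_iff: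
  assumes "vector_space s"
  shows "tensor3_class s p = tensor3_class s q \<longleftrightarrow>
    (\<forall>f. trilinear_form s f \<longrightarrow>
       free_extend (*) (\<lambda>(x, y, z). f x y z) p = free_extend (*) (\<lambda>(x, y, z). f x y z) q)"
proof -
  have *: "(\<forall>h :: 'b \<times> 'b \<times> 'b \<Rightarrow> 'a. P h) \<longleftrightarrow> (\<forall>f. P (\<lambda>(x, y, z). f x y z))" for P
  proof
    assume r: "\<forall>f. P (\<lambda>(x, y, z). f x y z)"
    show "\<forall>h. P h"
    proof
      fix h :: "'b \<times> 'b \<times> 'b \<Rightarrow> 'a"
      show "P h" using r[rule_format, of "\<lambda>x y z. h (x, y, z)"] by simp
    qed
  qed blast
  show ?thesis
    unfolding tensor3_class_def tensor3_rel_def free_span_coset_eq_iff * ball_Un ball_Collect_ex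
    using assms
    by (intro iff_allI imp_cong refl)
      (simp add: trilinear_form_def functional_iff linear_diff[OF functional_free_extend];
        simp add: diff_eq_eq add.commute; auto)
qed

text \<open>\<open>tensor_lift\<close> is a finite sum over the keys of one chosen representative,
  so a linear map passes through it term by term.\<close>

lemma linear_tensor_lift:
  assumes "Vector_Spaces.linear r r' \<phi>"
  shows "\<phi> (tensor_lift r f X) = tensor_lift r' (\<lambda>x y. \<phi> (f x y)) X"
  using assms unfolding tensor_lift_def free_extend_def linear_sum[OF assms]
  by (simp add: Vector_Spaces.linear_iff split_beta)

text \<open>Extensionality for tensors: it reduces equalities of coproducts to equalities of scalar
  Sweedler sums.\<close>

lemma tensor_space_eqI:
  assumes "vector_space s" "vector_space t" "X \<in> tensor_space s t" "Y \<in> tensor_space s t"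
    and "\<And>f. bilinear_map s t (*) f \<Longrightarrow> tensor_lift (*) f X = tensor_lift (*) f Y"
  shows "X = Y"
proof -
  obtain p q where X: "X = tensor_class s t p" and Y: "Y = tensor_class s t q"
    using assms(3,4) by (auto simp: tensor_space_def)
  show ?thesis
    using assms(5) unfolding X Y tensor_class_eq_iff[OF assms(1,2)]
    by (simp add: tensor_lift_class)
qed

lemma tensor_lift_add:
  assumes "bilinear_map s t (*) f"
  shows "tensor_lift (*) f (tensor_add s t X Y) = tensor_lift (*) f X + tensor_lift (*) f Y"
  unfolding tensor_add_def tensor_lift_class[OF assms]
  using functional_free_extend[of "\<lambda>(x, y). f x y"] by (simp add: functional_iff tensor_lift_def)

lemma tensor_lift_scale:
  assumes "bilinear_map s t (*) f"
  shows "tensor_lift (*) f (tensor_scale s t a X) = a * tensor_lift (*) f X"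
  unfolding tensor_scale_def tensor_lift_class[OF assms]
  using functional_free_extend[of "\<lambda>(x, y). f x y"] by (simp add: functional_iff tensor_lift_def)

lemma tensor_lift_map:
  assumes "bilinear_map s t (*) f"
  shows "tensor_lift (*) f (tensor_map s t g h X) = tensor_lift (*) (\<lambda>x y. f (g x) (h y)) X"
  unfolding tensor_map_def tensor_lift_class[OF assms]
    linear_tensor_lift[OF functional_free_extend] by simp

lemma tensor_lift_swap:
  assumes "bilinear_map t s (*) f"
  shows "tensor_lift (*) f (tensor_swap s t X) = tensor_lift (*) (\<lambda>x y. f y x) X"
  unfolding tensor_swap_def tensor_lift_class[OF assms]
    linear_tensor_lift[OF functional_free_extend] by simp

lemma tensor_ops_in_space [simp]:
  "tensor_add s t X Y \<in> tensor_space s t"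
  "tensor_scale s t a X \<in> tensor_space s t"
  "tensor_map s t g h Z \<in> tensor_space s t"
  "tensor_swap s t X \<in> tensor_space t s"
  by (simp_all add: tensor_space_def tensor_add_def tensor_scale_def tensor_map_def tensor_swap_def)

section \<open>Sweedler operators\<close>

lemma functional_intros:
  "functional s f \<Longrightarrow> functional s g \<Longrightarrow> functional s (\<lambda>x. f x + g x)"
  "functional s f \<Longrightarrow> functional s (\<lambda>x. a * f x)"
  "functional s f \<Longrightarrow> functional s (\<lambda>x. f x * a)"
  by (auto simp: functional_iff algebra_simps)

lemma functional_compose:
  "functional t f \<Longrightarrow> Vector_Spaces.linear s t T \<Longrightarrow> functional s (\<lambda>x. f (T x))"
  by (auto simp: Vector_Spaces.linear_iff)

text \<open>Weights and points are fixed before f, so the operator is linear in f on all functions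
  of two variables, and two such operators commute as finite double sums.\<close>

definition finite_sum_operator :: "(('c \<Rightarrow> 'd \<Rightarrow> 'k::field) \<Rightarrow> 'k) \<Rightarrow> bool" where
  "finite_sum_operator F \<longleftrightarrow> (\<exists>(n::nat) a u v. \<forall>f. F f = (\<Sum>i<n. a i * f (u i) (v i)))"

lemma finite_sum_operator_commute:
  assumes "finite_sum_operator F" "finite_sum_operator G"
  shows "F (\<lambda>x y. G (\<lambda>u v. h x y u v)) = G (\<lambda>u v. F (\<lambda>x y. h x y u v))"
proof -
  obtain n a u v where F: "\<And>f. F f = (\<Sum>i<(n::nat). a i * f (u i) (v i))"
    using assms(1) unfolding finite_sum_operator_def by blast
  obtain m a' u' v' where G: "\<And>f. G f = (\<Sum>i<(m::nat). a' i * f (u' i) (v' i))"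
    using assms(2) unfolding finite_sum_operator_def by blast
  show ?thesis
    unfolding F G sum_distrib_left by (subst sum.swap) (simp add: mult.left_commute)
qed

lemma finite_sum_operator_add:
  "finite_sum_operator F \<Longrightarrow> F (\<lambda>x y. f x y + g x y) = F f + F g"
  by (auto simp: finite_sum_operator_def algebra_simps sum.distrib)

lemma finite_sum_operator_scale:
  assumes "finite_sum_operator F"
  shows "F (\<lambda>x y. a * f x y) = a * F f" "F (\<lambda>x y. f x y * a) = F f * a"
  using assms by (auto simp: finite_sum_operator_def sum_distrib_left sum_distrib_right algebra_simps)

lemma functional_finite_sum_operator:
  assumes F: "finite_sum_operator F" and f: "\<And>u v. functional s (\<lambda>x. f x u v)"
  shows "functional s (\<lambda>x. F (\<lambda>u v. f x u v))"
proof -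
  have "f (x + y) = (\<lambda>u v. f x u v + f y u v)" "f (s a x) = (\<lambda>u v. a * f x u v)" for a x y
    using f by (auto simp: functional_iff fun_eq_iff)
  then show ?thesis
    using f by (simp add: functional_iff finite_sum_operator_add[OF F] finite_sum_operator_scale[OF F])
qed

lemma finite_sum_operator_sweedler: "finite_sum_operator (sweedler C c)"
proof -
  let ?p = "tensor_rep (comult C c)"
  obtain n :: nat and h where h: "bij_betw h {..<n} (Poly_Mapping.keys ?p)"
    using ex_bij_betw_nat_finite[of "Poly_Mapping.keys ?p"] by (auto simp: atLeast0LessThan)
  have "sweedler C c f =
      (\<Sum>i<n. Poly_Mapping.lookup ?p (h i) * f (fst (h i)) (snd (h i)))" for f
    unfolding sweedler_def tensor_lift_def free_extend_def
    using sum.reindex_bij_betw[OF h, of "\<lambda>z. Poly_Mapping.lookup ?p z * f (fst z) (snd z)"]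
    by (simp add: split_beta)
  then show ?thesis
    unfolding finite_sum_operator_def
    by (intro exI[of _ n] exI[of _ "\<lambda>i. Poly_Mapping.lookup ?p (h i)"]
        exI[of _ "\<lambda>i. fst (h i)"] exI[of _ "\<lambda>i. snd (h i)"]) simp
qed

text \<open> \<open>W c f\<close> stands for \<open>f(c\<^sub>(\<^sub>1\<^sub>), c\<^sub>(\<^sub>2\<^sub>))\<close>. \<close>

locale sweedler_operator =
  fixes s :: "'k::field \<Rightarrow> 'c::ab_group_add \<Rightarrow> 'c"
    and W :: "'c \<Rightarrow> ('c \<Rightarrow> 'c \<Rightarrow> 'k) \<Rightarrow> 'k"
    and \<epsilon> :: "'c \<Rightarrow> 'k"
  assumes finite_sum: "finite_sum_operator (W c)"
    and functional_counit: "functional s \<epsilon>"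
    and functional_W:
      "(\<And>x. functional s (\<lambda>y. f x y)) \<Longrightarrow> (\<And>y. functional s (\<lambda>x. f x y)) \<Longrightarrow>
        functional s (\<lambda>c. W c f)"
    and coassoc: "trilinear_form s g \<Longrightarrow>
      W c (\<lambda>x y. W x (\<lambda>u v. g u v y)) = W c (\<lambda>x y. W y (\<lambda>u v. g x u v))"
    and counit_left: "functional s h \<Longrightarrow> W c (\<lambda>x y. \<epsilon> x * h y) = h c"
    and counit_right: "functional s h \<Longrightarrow> W c (\<lambda>x y. h x * \<epsilon> y) = h c"
begin

lemmas add = finite_sum_operator_add[OF finite_sum]
lemmas scale = finite_sum_operator_scale[OF finite_sum]
lemmas functional_inner = functional_finite_sum_operator[OF finite_sum]

end

text \<open>The Sweedler operator of the co-opposite coalgebra. Exchanging the arguments of f keeps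
  the same finite sum and makes flipping an involution, whereas \<open>sweedler (cop C)\<close>
  rests on a newly chosen representative and is compared with it on bilinear forms.\<close>

definition flip :: "('c \<Rightarrow> ('c \<Rightarrow> 'c \<Rightarrow> 'k) \<Rightarrow> 'k) \<Rightarrow> 'c \<Rightarrow> ('c \<Rightarrow> 'c \<Rightarrow> 'k) \<Rightarrow> 'k" where
  "flip W c f = W c (\<lambda>x y. f y x)"

lemma flip_flip [simp]: "flip (flip W) = W"
  by (intro ext) (simp add: flip_def)

lemma sweedler_operator_flip:
  assumes "sweedler_operator s W \<epsilon>"
  shows "sweedler_operator s (flip W) \<epsilon>"
proof -
  interpret sweedler_operator s W \<epsilon> by fact
  show ?thesis
  proof (rule sweedler_operator.intro)
    fix c
    obtain n a u v where "\<And>f. W c f = (\<Sum>i<(n::nat). a i * f (u i) (v i))"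
      using finite_sum[of c] unfolding finite_sum_operator_def by blast
    then show "finite_sum_operator (flip W c)"
      unfolding finite_sum_operator_def flip_def
      by (intro exI[of _ n] exI[of _ a] exI[of _ v] exI[of _ u]) simp
  next
    fix g c
    assume "trilinear_form s g"
    \<comment> \<open>Reading g backwards turns each of the two coassociativity sums of the flipped
      operator into the other one of W.\<close>
    then have "trilinear_form s (\<lambda>x y z. g z y x)" by (simp add: trilinear_form_def)
    from coassoc[OF this, of c]
    show "flip W c (\<lambda>x y. flip W x (\<lambda>u v. g u v y)) = flip W c (\<lambda>x y. flip W y (\<lambda>u v. g x u v))"
      by (simp add: flip_def)
  qed (use counit_left counit_right in
      \<open>auto simp: flip_def mult.commute intro: functional_counit functional_W\<close>)
qed

text \<open>Each tensor axiom becomes scalar by testing: linearity of the coproduct on bilinear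
  forms, coassociativity on trilinear forms, the counit laws on functionals. Membership in the
  tensor space is kept because an operator on forms does not see whether the value of
  \<open>comult\<close> is a coset.\<close>

lemma is_coalgebra_iff:
  "is_coalgebra C \<longleftrightarrow> (\<forall>c. comult C c \<in> tensor_space (smult C) (smult C)) \<and>
     sweedler_operator (smult C) (sweedler C) (counit C)"
  (is "?L \<longleftrightarrow> ?R")
proof -
  let ?s = "smult C"
  have bil: "bilinear_map ?s ?s (*) f \<longleftrightarrow>
      (\<forall>x. functional ?s (\<lambda>y. f x y)) \<and> (\<forall>y. functional ?s (\<lambda>x. f x y))" for f
    by (rule bilinear_map_times_iff)
  have coassoc_iff: "comult_left C (comult C c) = comult_right C (comult C c) \<longleftrightarrow>
      (\<forall>g. trilinear_form ?s g \<longrightarrow>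
        sweedler C c (\<lambda>x y. sweedler C x (\<lambda>u v. g u v y)) =
        sweedler C c (\<lambda>x y. sweedler C y (\<lambda>u v. g x u v)))" if "vector_space ?s" for c
    unfolding comult_left_def comult_right_def tensor3_class_eq_iff[OF that]
      linear_tensor_lift[OF functional_free_extend] sweedler_def by simp
  have counit_left_iff:
    "tensor_lift ?s (\<lambda>x y. ?s (counit C x) y) (comult C c) = c \<longleftrightarrow>
      (\<forall>h. functional ?s h \<longrightarrow> sweedler C c (\<lambda>x y. counit C x * h y) = h c)"
    if vs: "vector_space ?s" for c
  proof -
    have "h (tensor_lift ?s (\<lambda>x y. ?s (counit C x) y) (comult C c)) =
        sweedler C c (\<lambda>x y. counit C x * h y)" if "functional ?s h" for h
      unfolding sweedler_def linear_tensor_lift[OF that] using that by (simp add: functional_iff)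
    then show ?thesis by (metis functionals_eqI[OF vs])
  qed
  have counit_right_iff:
    "tensor_lift ?s (\<lambda>x y. ?s (counit C y) x) (comult C c) = c \<longleftrightarrow>
      (\<forall>h. functional ?s h \<longrightarrow> sweedler C c (\<lambda>x y. h x * counit C y) = h c)"
    if vs: "vector_space ?s" for c
  proof -
    have "h (tensor_lift ?s (\<lambda>x y. ?s (counit C y) x) (comult C c)) =
        sweedler C c (\<lambda>x y. h x * counit C y)" if "functional ?s h" for h
      unfolding sweedler_def linear_tensor_lift[OF that] using that
      by (simp add: functional_iff mult.commute)
    then show ?thesis by (metis functionals_eqI[OF vs])
  qed
  show ?thesis
  proof
    assume L: ?L
    then have vs: "vector_space ?s" by (simp add: is_coalgebra_def)
    show ?R
    proof (intro conjI sweedler_operator.intro)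
      show "functional ?s (\<lambda>c. sweedler C c f)"
        if "\<And>x. functional ?s (\<lambda>y. f x y)" "\<And>y. functional ?s (\<lambda>x. f x y)" for f
      proof -
        have "bilinear_map ?s ?s (*) f" using that by (simp add: bil)
        then show ?thesis
          using L unfolding is_coalgebra_def sweedler_def functional_iff[of _ "\<lambda>c. _ c"]
          by (auto simp: tensor_lift_add tensor_lift_scale)
      qed
    qed (use L vs in \<open>auto simp: is_coalgebra_def coassoc_iff counit_left_iff counit_right_iff
        finite_sum_operator_sweedler\<close>)
  next
    assume R: ?R
    then interpret sweedler_operator ?s "sweedler C" "counit C" by simp
    have vs: "vector_space ?s" using functional_counit by (simp add: functional_iff)
    have lin: "functional ?s (\<lambda>c. tensor_lift (*) f (comult C c))"
      if "bilinear_map ?s ?s (*) f" for f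
      using functional_W[of f] that by (simp add: bil sweedler_def)
    have "comult C (c + d) = tensor_add ?s ?s (comult C c) (comult C d)" for c d
      by (rule tensor_space_eqI[OF vs vs])
        (use R lin in \<open>auto simp: tensor_lift_add functional_iff\<close>)
    moreover have "comult C (?s a c) = tensor_scale ?s ?s a (comult C c)" for a c
      by (rule tensor_space_eqI[OF vs vs])
        (use R lin in \<open>auto simp: tensor_lift_scale functional_iff\<close>)
    ultimately show ?L
      using R vs functional_counit coassoc counit_left counit_right
      unfolding is_coalgebra_def
      by (simp add: coassoc_iff counit_left_iff counit_right_iff)
  qed
qed

section \<open>Co-opposite and direct sum of coalgebras\<close>

lemma sweedler_cop:
  assumes "bilinear_form C f"
  shows "sweedler (cop C) c f = flip (sweedler C) c f"
  using assms by (simp add: sweedler_def cop_def flip_def tensor_lift_swap bilinear_form_def)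

lemma sweedler_coalgebra_sum:
  fixes C :: "('k::field, 'c::ab_group_add) coalgebra"
    and D :: "('k, 'd::ab_group_add) coalgebra"
  assumes "bilinear_form (coalgebra_sum C D) f"
  shows "sweedler (coalgebra_sum C D) x f =
    sweedler C (fst x) (\<lambda>u v. f (u, 0) (v, 0)) + sweedler D (snd x) (\<lambda>u v. f (0, u) (0, v))"
  using assms
  by (simp add: sweedler_def coalgebra_sum_def Let_def split_beta bilinear_form_def
      tensor_lift_add tensor_lift_map)

text \<open>This transfers the axioms to a coproduct whose representative was chosen afresh. The
  nested sums in the axioms are again bilinear in the outer variables, which lets the comparison be
  applied at both levels.\<close>

lemma sweedler_operator_cong:
  assumes V: "sweedler_operator s V \<epsilon>" and fin: "\<And>c. finite_sum_operator (W c)"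
    and eq: "\<And>c f. bilinear_map s s (*) f \<Longrightarrow> W c f = V c f"
  shows "sweedler_operator s W \<epsilon>"
proof -
  interpret V: sweedler_operator s V \<epsilon> by fact
  have W: "W c f = V c f"
    if "\<And>x. functional s (\<lambda>y. f x y)" "\<And>y. functional s (\<lambda>x. f x y)" for c f
    using that eq by (simp add: bilinear_map_times_iff)
  show ?thesis
  proof (rule sweedler_operator.intro)
    fix g c
    assume g: "trilinear_form s g"
    have g': "functional s (\<lambda>x. g x y z)" "functional s (\<lambda>x. g y x z)" "functional s (\<lambda>x. g y z x)"
      for y z using g by (auto simp: trilinear_form_def)
    show "W c (\<lambda>x y. W x (\<lambda>u v. g u v y)) = W c (\<lambda>x y. W y (\<lambda>u v. g x u v))"
      by (simp add: W g' V.functional_W V.functional_inner V.coassoc[OF g])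
  next
    fix h c
    assume h: "functional s h"
    show "W c (\<lambda>x y. \<epsilon> x * h y) = h c" "W c (\<lambda>x y. h x * \<epsilon> y) = h c"
      by (simp_all add: W functional_intros V.functional_counit h V.counit_left V.counit_right)
  qed (auto simp: W fin V.functional_counit V.functional_W)
qed

lemma cop_simps [simp]: "smult (cop C) = smult C" "counit (cop C) = counit C"
  by (simp_all add: cop_def)

lemma is_coalgebra_cop:
  assumes "is_coalgebra C"
  shows "is_coalgebra (cop C)"
proof -
  have "sweedler_operator (smult C) (sweedler (cop C)) (counit C)"
    by (rule sweedler_operator_cong[OF sweedler_operator_flip])
      (use assms in \<open>auto simp: is_coalgebra_iff sweedler_cop bilinear_form_def
        intro: finite_sum_operator_sweedler\<close>)
  then show ?thesis by (simp add: is_coalgebra_iff) (simp add: cop_def)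
qed

lemma linear_prod:
  assumes s: "vector_space s" and t: "vector_space t"
  defines "p \<equiv> module_prod.scale s t"
  shows "vector_space p" "Vector_Spaces.linear s p (\<lambda>x. (x, 0))"
    "Vector_Spaces.linear t p (\<lambda>y. (0, y))"
    "Vector_Spaces.linear p s fst" "Vector_Spaces.linear p t snd"
proof -
  interpret s: vector_space s by fact
  interpret t: vector_space t by fact
  have p: "p a (x, y) = (s a x, t a y)" for a x y
    unfolding p_def
    by (simp add: module_prod.scale_def module_prod_def module_pair_def s.module_axioms t.module_axioms)
  show vs: "vector_space p"
    by unfold_locales (auto simp: p s.scale_right_distrib t.scale_right_distrib
      s.scale_left_distrib t.scale_left_distrib)
  show "Vector_Spaces.linear s p (\<lambda>x. (x, 0))" "Vector_Spaces.linear t p (\<lambda>y. (0, y))"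
    "Vector_Spaces.linear p s fst" "Vector_Spaces.linear p t snd"
    using vs s t by (auto simp: Vector_Spaces.linear_iff p)
qed

lemma linear_coalgebra_sum:
  assumes "vector_space (smult C)" "vector_space (smult D)"
  defines "p \<equiv> smult (coalgebra_sum C D)"
  shows "vector_space p" "Vector_Spaces.linear (smult C) p (\<lambda>x. (x, 0))"
    "Vector_Spaces.linear (smult D) p (\<lambda>y. (0, y))"
    "Vector_Spaces.linear p (smult C) fst" "Vector_Spaces.linear p (smult D) snd"
  using linear_prod[OF assms(1,2)] by (simp_all add: p_def coalgebra_sum_def Let_def)

text \<open>No term of the coproduct mixes the summands, so testing against forms splits every axiom
  into one for C and one for D.\<close>

lemma is_coalgebra_sum:
  fixes C :: "('k::field, 'c::ab_group_add) coalgebra"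
    and D :: "('k, 'd::ab_group_add) coalgebra"
  assumes C: "is_coalgebra C" and D: "is_coalgebra D"
  shows "is_coalgebra (coalgebra_sum C D)"
proof -
  let ?S = "coalgebra_sum C D"
  interpret C: sweedler_operator "smult C" "sweedler C" "counit C"
    using C by (simp add: is_coalgebra_iff)
  interpret D: sweedler_operator "smult D" "sweedler D" "counit D"
    using D by (simp add: is_coalgebra_iff)
  have "vector_space (smult C)" "vector_space (smult D)"
    using C.functional_counit D.functional_counit by (simp_all add: functional_iff)
  note lin = linear_coalgebra_sum[OF this]
  have counit: "counit ?S x = counit C (fst x) + counit D (snd x)" for x
    by (simp add: coalgebra_sum_def Let_def split_beta)
  have W: "sweedler ?S x f =
      sweedler C (fst x) (\<lambda>u v. f (u, 0) (v, 0)) + sweedler D (snd x) (\<lambda>u v. f (0, u) (0, v))"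
    if "\<And>x. functional (smult ?S) (\<lambda>y. f x y)" "\<And>y. functional (smult ?S) (\<lambda>x. f x y)" for x f
    using that by (simp add: sweedler_coalgebra_sum bilinear_form_def bilinear_map_times_iff)
  have inl: "functional (smult C) (\<lambda>x. f (x, 0))" and inr: "functional (smult D) (\<lambda>y. f (0, y))"
    if "functional (smult ?S) f" for f :: "'c \<times> 'd \<Rightarrow> 'k"
    using that lin(2,3) by (auto intro: functional_compose)
  have outl: "functional (smult ?S) (\<lambda>x. f (fst x))" if "functional (smult C) f"
    for f :: "'c \<Rightarrow> 'k" using that lin(4) by (rule functional_compose)
  have outr: "functional (smult ?S) (\<lambda>x. f (snd x))" if "functional (smult D) f"
    for f :: "'d \<Rightarrow> 'k" using that lin(5) by (rule functional_compose)
  have functional_W: "functional (smult ?S) (\<lambda>c. sweedler ?S c f)"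
    if "\<And>x. functional (smult ?S) (\<lambda>y. f x y)" "\<And>y. functional (smult ?S) (\<lambda>x. f x y)" for f
    unfolding W[OF that]
    by (intro functional_intros outl outr C.functional_W D.functional_W inl inr that)
  have "sweedler_operator (smult ?S) (sweedler ?S) (counit ?S)"
  proof (rule sweedler_operator.intro)
    show "finite_sum_operator (sweedler ?S c)" for c by (rule finite_sum_operator_sweedler)
    show "functional (smult ?S) (counit ?S)"
      using functional_intros(1)[OF outl outr, OF C.functional_counit D.functional_counit]
      by (simp add: counit[abs_def])
    show "functional (smult ?S) (\<lambda>c. sweedler ?S c f)"
      if "\<And>x. functional (smult ?S) (\<lambda>y. f x y)" "\<And>y. functional (smult ?S) (\<lambda>x. f x y)" for f
      using that by (rule functional_W)
  next
    fix h c
    assume h: "functional (smult ?S) h"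
    have h_split: "h (x, 0) + h (0, y) = h (x, y)" for x y
      using h[unfolded functional_iff, THEN conjunct2, THEN conjunct1, rule_format, of "(x, 0)" "(0, y)"]
      by simp
    note zero = linear_zero[OF C.functional_counit] linear_zero[OF D.functional_counit]
    have "functional (smult ?S) (counit ?S)"
      using functional_intros(1)[OF outl outr, OF C.functional_counit D.functional_counit]
      by (simp add: counit[abs_def])
    then show "sweedler ?S c (\<lambda>x y. counit ?S x * h y) = h c"
      "sweedler ?S c (\<lambda>x y. h x * counit ?S y) = h c"
      by (simp_all add: W functional_intros h)
        (simp_all add: counit zero C.counit_left D.counit_left C.counit_right D.counit_right
          inl inr h h_split)
  next
    fix g c
    assume g: "trilinear_form (smult ?S) g"
    then have g': "functional (smult ?S) (\<lambda>x. g x y z)" "functional (smult ?S) (\<lambda>x. g y x z)"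
      "functional (smult ?S) (\<lambda>x. g y z x)" for y z unfolding trilinear_form_def by blast+
    have tri: "trilinear_form (smult C) (\<lambda>x y z. g (x, 0) (y, 0) (z, 0))"
      "trilinear_form (smult D) (\<lambda>x y z. g (0, x) (0, y) (0, z))"
      by (auto simp: trilinear_form_def intro!: inl[OF g'(1)] inl[OF g'(2)] inl[OF g'(3)]
          inr[OF g'(1)] inr[OF g'(2)] inr[OF g'(3)])
    \<comment> \<open>An inner sum at (x, 0) still has a D part, taken at 0, and symmetrically for
      (0, x). These parts vanish because the Sweedler sum of a bilinear form is linear in the
      element.\<close>
    have zero: "sweedler C 0 (\<lambda>u v. f (u, 0) (v, 0)) = 0" "sweedler D 0 (\<lambda>u v. f (0, u) (0, v)) = 0"
      if "\<And>x. functional (smult ?S) (\<lambda>y. f x y)" "\<And>y. functional (smult ?S) (\<lambda>x. f x y)" for f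
      by (intro linear_zero[OF C.functional_W] linear_zero[OF D.functional_W] inl inr that)+
    have functional_inner: "functional (smult ?S) (\<lambda>x. sweedler ?S c (\<lambda>u v. f x u v))"
      if "\<And>u v. functional (smult ?S) (\<lambda>x. f x u v)" for f c
      using finite_sum_operator_sweedler that by (rule functional_finite_sum_operator)
    have outer: "sweedler ?S c (\<lambda>x y. sweedler ?S x (\<lambda>u v. g u v y)) =
        sweedler C (fst c) (\<lambda>x y. sweedler ?S (x, 0) (\<lambda>u v. g u v (y, 0))) +
        sweedler D (snd c) (\<lambda>x y. sweedler ?S (0, x) (\<lambda>u v. g u v (0, y)))"
      "sweedler ?S c (\<lambda>x y. sweedler ?S y (\<lambda>u v. g x u v)) =
        sweedler C (fst c) (\<lambda>x y. sweedler ?S (y, 0) (\<lambda>u v. g (x, 0) u v)) +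
        sweedler D (snd c) (\<lambda>x y. sweedler ?S (0, y) (\<lambda>u v. g (0, x) u v))"
      by (intro W functional_W functional_inner g')+
    show "sweedler ?S c (\<lambda>x y. sweedler ?S x (\<lambda>u v. g u v y)) =
        sweedler ?S c (\<lambda>x y. sweedler ?S y (\<lambda>u v. g x u v))"
      unfolding outer
      by (simp add: W g' zero[of "\<lambda>u v. g u v _"] zero[of "\<lambda>u v. g _ u v"]
          C.coassoc[OF tri(1)] D.coassoc[OF tri(2)])
  qed
  moreover have "comult ?S c \<in> tensor_space (smult ?S) (smult ?S)" for c
    by (simp add: coalgebra_sum_def Let_def split_beta)
  ultimately show ?thesis by (simp add: is_coalgebra_iff)
qed

section \<open>Convolution of bilinear forms\<close>

text \<open>The product in the dual of the tensor product of two coalgebras. Separate operators for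
  the two arguments allow either coproduct to be reversed on its own, as forms on C times C^cop
  require.\<close>

definition conv ::
  "('c \<Rightarrow> ('c \<Rightarrow> 'c \<Rightarrow> 'k::field) \<Rightarrow> 'k) \<Rightarrow> ('d \<Rightarrow> ('d \<Rightarrow> 'd \<Rightarrow> 'k) \<Rightarrow> 'k) \<Rightarrow>
    ('c \<Rightarrow> 'd \<Rightarrow> 'k) \<Rightarrow> ('c \<Rightarrow> 'd \<Rightarrow> 'k) \<Rightarrow> 'c \<Rightarrow> 'd \<Rightarrow> 'k"
where
  "conv W V f g c d = W c (\<lambda>c1 c2. V d (\<lambda>d1 d2. f c1 d1 * g c2 d2))"

locale sweedler_operator_pair =
  A: sweedler_operator s W \<epsilon> + B: sweedler_operator t V \<delta>
  for s :: "'k::field \<Rightarrow> 'c::ab_group_add \<Rightarrow> 'c" and W \<epsilon>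
    and t :: "'k \<Rightarrow> 'd::ab_group_add \<Rightarrow> 'd" and V \<delta>
begin

abbreviation bil :: "('c \<Rightarrow> 'd \<Rightarrow> 'k) \<Rightarrow> bool" where
  "bil \<equiv> bilinear_map s t (*)"

lemma bilD:
  assumes "bil f"
  shows "functional t (\<lambda>y. f x y)" "functional s (\<lambda>x. f x y)"
  using assms by (simp_all add: bilinear_map_times_iff)

lemmas commute = finite_sum_operator_commute[OF A.finite_sum B.finite_sum]

lemma bil_conv:
  assumes "bil f" "bil g"
  shows "bil (conv W V f g)"
  unfolding bilinear_map_times_iff conv_def[abs_def]
  by (intro conjI allI A.functional_W A.functional_inner B.functional_W B.functional_inner
      functional_intros bilD assms)

text \<open>Exchanging the sums over c1 and d puts the two nested coproducts of d next to each
  other; coassociativity is then applied to d inside and to c outside.\<close>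

lemma conv_assoc:
  assumes f: "bil f" and g: "bil g" and h: "bil h"
  shows "conv W V (conv W V f g) h = conv W V f (conv W V g h)"
proof (intro ext)
  fix c d
  have triB: "trilinear_form t (\<lambda>x y z. f u x * g v y * h w z)" for u v w
    unfolding trilinear_form_def by (intro conjI allI functional_intros bilD f g h)
  have triA: "trilinear_form s (\<lambda>x y z. V d (\<lambda>d1 d2. V d2 (\<lambda>u v. f x d1 * g y u * h z v)))"
    unfolding trilinear_form_def
    by (intro conjI allI B.functional_inner functional_intros bilD f g h)
  have "conv W V (conv W V f g) h c d =
      W c (\<lambda>c1 c2. V d (\<lambda>d1 d2. W c1 (\<lambda>x y. V d1 (\<lambda>u v. f x u * g y v * h c2 d2))))"
    by (simp add: conv_def A.scale B.scale)
  also have "\<dots> = W c (\<lambda>c1 c2. W c1 (\<lambda>x y. V d (\<lambda>d1 d2. V d1 (\<lambda>u v. f x u * g y v * h c2 d2))))"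
    by (simp add: commute)
  also have "\<dots> = W c (\<lambda>c1 c2. W c1 (\<lambda>x y. V d (\<lambda>d1 d2. V d2 (\<lambda>u v. f x d1 * g y u * h c2 v))))"
    by (simp add: B.coassoc[OF triB])
  also have "\<dots> = W c (\<lambda>c1 c2. W c2 (\<lambda>x y. V d (\<lambda>d1 d2. V d2 (\<lambda>u v. f c1 d1 * g x u * h y v))))"
    by (rule A.coassoc[OF triA])
  also have "\<dots> = conv W V f (conv W V g h) c d"
    by (simp add: conv_def A.scale B.scale mult.assoc commute)
  finally show "conv W V (conv W V f g) h c d = conv W V f (conv W V g h) c d" .
qed

lemma conv_one:
  assumes "bil f"
  shows "conv W V (\<lambda>c d. \<epsilon> c * \<delta> d) f = f" "conv W V f (\<lambda>c d. \<epsilon> c * \<delta> d) = f"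
proof -
  have "V d (\<lambda>d1 d2. \<epsilon> c1 * \<delta> d1 * f c2 d2) = \<epsilon> c1 * f c2 d"
    "V d (\<lambda>d1 d2. f c1 d1 * (\<epsilon> c2 * \<delta> d2)) = f c1 d * \<epsilon> c2" for c1 c2 d
    using B.scale(1)[of d "\<epsilon> c1" "\<lambda>d1 d2. \<delta> d1 * f c2 d2"] B.counit_left[OF bilD(1)[OF assms]]
      B.scale(1)[of d "\<epsilon> c2" "\<lambda>d1 d2. f c1 d1 * \<delta> d2"] B.counit_right[OF bilD(1)[OF assms]]
    by (simp_all add: ac_simps)
  then show "conv W V (\<lambda>c d. \<epsilon> c * \<delta> d) f = f" "conv W V f (\<lambda>c d. \<epsilon> c * \<delta> d) = f"
    by (simp_all add: conv_def fun_eq_iff A.counit_left A.counit_right bilD[OF assms])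
qed

definition inverse_forms :: "('c \<Rightarrow> 'd \<Rightarrow> 'k) \<Rightarrow> ('c \<Rightarrow> 'd \<Rightarrow> 'k) \<Rightarrow> bool" where
  "inverse_forms f g \<longleftrightarrow> bil f \<and> bil g \<and>
     conv W V f g = (\<lambda>c d. \<epsilon> c * \<delta> d) \<and> conv W V g f = (\<lambda>c d. \<epsilon> c * \<delta> d)"

lemma inverse_forms_unique:
  assumes "inverse_forms f g" "inverse_forms f h"
  shows "g = h"
  using assms conv_assoc[of g f h] conv_one unfolding inverse_forms_def by metis

end

lemma sweedler_operator_pair_flip:
  assumes "sweedler_operator_pair s W \<epsilon> t V \<delta>"
  shows "sweedler_operator_pair s (flip W) \<epsilon> t V \<delta>" "sweedler_operator_pair s W \<epsilon> t (flip V) \<delta>"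
    "sweedler_operator_pair t V \<delta> s W \<epsilon>"
  using assms sweedler_operator_flip unfolding sweedler_operator_pair_def by auto

text \<open>Reversing both coproducts passes to the opposite convolution algebra, in which a
  two-sided inverse is still one.\<close>

lemma inverse_forms_flip:
  assumes "sweedler_operator_pair s W \<epsilon> t V \<delta>"
    and "sweedler_operator_pair.inverse_forms s W \<epsilon> t V \<delta> f g"
  shows "sweedler_operator_pair.inverse_forms s (flip W) \<epsilon> t (flip V) \<delta> f g"
  using assms sweedler_operator_pair_flip[OF assms(1)]
    sweedler_operator_pair_flip(2)[of s "flip W" \<epsilon> t V \<delta>]
  by (simp add: sweedler_operator_pair.inverse_forms_def conv_def[abs_def] flip_def mult.commute)

lemma inverse_forms_swap:
  assumes "sweedler_operator_pair s W \<epsilon> t V \<delta>"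
    and "sweedler_operator_pair.inverse_forms s W \<epsilon> t V \<delta> f g"
  shows "sweedler_operator_pair.inverse_forms t V \<delta> s W \<epsilon> (\<lambda>d c. f c d) (\<lambda>d c. g c d)"
proof -
  interpret sweedler_operator_pair s W \<epsilon> t V \<delta> by fact
  interpret op: sweedler_operator_pair t V \<delta> s W \<epsilon>
    using assms(1) by (rule sweedler_operator_pair_flip)
  show ?thesis
    using assms(2) unfolding inverse_forms_def op.inverse_forms_def
    by (auto simp: conv_def fun_eq_iff bilinear_map_times_iff op.commute mult.commute)
qed

section \<open>Yang--Baxter identities\<close>

text \<open>In each variable the indices record the order of the two factors that share it: P, Q, R
  on the left and R, Q, P on the right. The three places carry different forms because inversion
  replaces a single factor.\<close>

definition yang_baxter ::
  "('c \<Rightarrow> ('c \<Rightarrow> 'c \<Rightarrow> 'k::field) \<Rightarrow> 'k) \<Rightarrow> ('d \<Rightarrow> ('d \<Rightarrow> 'd \<Rightarrow> 'k) \<Rightarrow> 'k) \<Rightarrow>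
    ('e \<Rightarrow> ('e \<Rightarrow> 'e \<Rightarrow> 'k) \<Rightarrow> 'k) \<Rightarrow>
    ('c \<Rightarrow> 'd \<Rightarrow> 'k) \<Rightarrow> ('c \<Rightarrow> 'e \<Rightarrow> 'k) \<Rightarrow> ('d \<Rightarrow> 'e \<Rightarrow> 'k) \<Rightarrow> bool"
where
  "yang_baxter W V U P Q R \<longleftrightarrow> (\<forall>c d e.
     W c (\<lambda>c1 c2. V d (\<lambda>d1 d2. U e (\<lambda>e1 e2. P c1 d1 * Q c2 e1 * R d2 e2))) =
     W c (\<lambda>c1 c2. V d (\<lambda>d1 d2. U e (\<lambda>e1 e2. P c2 d2 * Q c1 e2 * R d1 e1))))"

lemma yang_baxter_flip:
  "yang_baxter W V U P Q R \<Longrightarrow> yang_baxter (flip W) (flip V) (flip U) P Q R"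
  by (simp add: yang_baxter_def flip_def)

locale sweedler_operator_triple =
  A: sweedler_operator s W \<epsilon> + B: sweedler_operator t V \<delta> + D: sweedler_operator r U \<eta>
  for s :: "'k::field \<Rightarrow> 'c::ab_group_add \<Rightarrow> 'c" and W \<epsilon>
    and t :: "'k \<Rightarrow> 'd::ab_group_add \<Rightarrow> 'd" and V \<delta>
    and r :: "'k \<Rightarrow> 'e::ab_group_add \<Rightarrow> 'e" and U \<eta>
begin

sublocale AB: sweedler_operator_pair s W \<epsilon> t V \<delta> ..
sublocale AD: sweedler_operator_pair s W \<epsilon> r U \<eta> ..
sublocale BD: sweedler_operator_pair t V \<delta> r U \<eta> ..

text \<open>Listing the second variable first turns the order P, Q, R into P, R, Q. Only the third
  variable, shared by Q and R, notices this, and flipping U compensates.\<close>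

lemma yang_baxter_swap:
  assumes "yang_baxter W V U P Q R"
  shows "yang_baxter V W (flip U) (\<lambda>d c. P c d) R Q"
  using assms unfolding yang_baxter_def flip_def
  by (simp add: AB.commute[symmetric] mult.assoc mult.commute[of "R _ _"])

text \<open>Reading the variables backwards exchanges the two sides.\<close>

lemma yang_baxter_reverse:
  assumes "yang_baxter W V U P Q R"
  shows "yang_baxter U V W (\<lambda>e d. R d e) (\<lambda>e c. Q c e) (\<lambda>d c. P c d)"
  using assms unfolding yang_baxter_def
  by (simp add: AB.commute AD.commute BD.commute mult.assoc mult.commute mult.left_commute)

text \<open>
  Summing over \<open>c\<close> first, the identity reads \<open>G * R = R * H\<close> in the convolution algebra of
  forms on \<open>D \<times> E\<close>, so \<open>R\<inverse> * G = H * R\<inverse>\<close>.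
\<close>

lemma yang_baxter_inverse3:
  assumes yb: "yang_baxter W V U P Q R" and P: "AB.bil P" and Q: "AD.bil Q"
    and R: "BD.inverse_forms R R'"
  shows "yang_baxter W (flip V) (flip U) P Q R'"
  unfolding yang_baxter_def
proof (intro allI)
  fix c d e
  let ?G = "\<lambda>d e. W c (\<lambda>c1 c2. P c1 d * Q c2 e)"
  let ?H = "\<lambda>d e. W c (\<lambda>c1 c2. P c2 d * Q c1 e)"
  let ?conv = "conv V U"
  have G: "BD.bil ?G" and H: "BD.bil ?H"
    unfolding bilinear_map_times_iff
    by (intro conjI allI A.functional_inner functional_intros AB.bilD P AD.bilD Q)+
  have bil: "BD.bil R" "BD.bil R'" and one: "?conv R R' = (\<lambda>d e. \<delta> d * \<eta> e)"
    "?conv R' R = (\<lambda>d e. \<delta> d * \<eta> e)"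
    using R by (simp_all add: BD.inverse_forms_def)
  \<comment> \<open>Moves the sum over c to the inside, where it becomes \<open>?G\<close> or
    \<open>?H\<close>.\<close>
  have out: "W c (\<lambda>c1 c2. V d (\<lambda>d1 d2. U e (\<lambda>e1 e2. F c1 c2 d1 d2 e1 e2))) =
      V d (\<lambda>d1 d2. U e (\<lambda>e1 e2. W c (\<lambda>c1 c2. F c1 c2 d1 d2 e1 e2)))" for F d e
    by (simp add: AB.commute AD.commute)
  have "?conv ?G R = ?conv R ?H"
  proof (intro ext)
    fix d e
    show "?conv ?G R d e = ?conv R ?H d e"
      using yb[unfolded yang_baxter_def, THEN spec, of c, unfolded out]
        by (simp add: conv_def A.scale mult.commute[of "R _ _"])
  qed
  then have "?conv R' (?conv (?conv ?G R) R') = ?conv R' (?conv (?conv R ?H) R')"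
    by simp
  then have "?conv R' ?G = ?conv ?H R'"
    using BD.conv_assoc[OF G bil] BD.conv_assoc[OF bil(1) H bil(2)]
      BD.conv_assoc[OF bil(2,1) BD.bil_conv[OF H bil(2)]]
    by (simp add: one BD.conv_one G BD.bil_conv H bil)
  then have "?conv R' ?G d e = ?conv ?H R' d e" by simp
  \<comment> \<open>After unflipping, R' takes the first halves of d and e on the left and the
    second halves on the right, so the two sides are R' * G and H * R'.\<close>
  then show "W c (\<lambda>c1 c2. flip V d (\<lambda>d1 d2. flip U e (\<lambda>e1 e2. P c1 d1 * Q c2 e1 * R' d2 e2))) =
      W c (\<lambda>c1 c2. flip V d (\<lambda>d1 d2. flip U e (\<lambda>e1 e2. P c2 d2 * Q c1 e2 * R' d1 e1)))"
    unfolding flip_def out by (simp add: conv_def A.scale mult.commute[of "R' _ _"])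
qed

text \<open>T need not respect the coproduct of the third variable. The premises ask for what an
  automorphism condition supplies: Q and R both carry T on their shared argument, in either order of
  the halves.\<close>

lemma yang_baxter_twist3:
  assumes "yang_baxter W V U P Q R"
    and "\<And>x y e. U e (\<lambda>e1 e2. Q x (T e1) * R y (T e2)) = U (T e) (\<lambda>e1 e2. Q x e1 * R y e2)"
    and "\<And>x y e. U e (\<lambda>e1 e2. Q x (T e2) * R y (T e1)) = U (T e) (\<lambda>e1 e2. Q x e2 * R y e1)"
  shows "yang_baxter W V U P (\<lambda>c e. Q c (T e)) (\<lambda>d e. R d (T e))"
  using assms unfolding yang_baxter_def by (simp add: mult.assoc D.scale)

text \<open>Reversal moves P into the third place, where inversion is available; reversing again
  restores the order.\<close>

lemma yang_baxter_inverse1: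
  assumes "yang_baxter W V U P Q R" "AB.inverse_forms P P'" "AD.bil Q" "BD.bil R"
  shows "yang_baxter (flip W) (flip V) U P' Q R"
proof -
  interpret rev: sweedler_operator_triple r U \<eta> t V \<delta> s W \<epsilon> ..
  interpret fl: sweedler_operator_triple r U \<eta> t "flip V" \<delta> s "flip W" \<epsilon>
    by (intro sweedler_operator_triple.intro sweedler_operator_flip
        A.sweedler_operator_axioms B.sweedler_operator_axioms D.sweedler_operator_axioms)
  have "yang_baxter U (flip V) (flip W) (\<lambda>e d. R d e) (\<lambda>e c. Q c e) (\<lambda>d c. P' c d)"
    by (rule rev.yang_baxter_inverse3[OF yang_baxter_reverse[OF assms(1)]])
      (use assms(2-4) inverse_forms_swap[OF AB.sweedler_operator_pair_axioms] in
        \<open>auto simp: bilinear_map_times_iff\<close>)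
  from fl.yang_baxter_reverse[OF this] show ?thesis .
qed

text \<open>The swap moves Q into the third place but flips U, which is why Q' is an inverse
  relative to W and \<open>flip U\<close>. The inversion undoes this flip and the second swap
  restores it.\<close>

lemma yang_baxter_inverse2:
  assumes "yang_baxter W V U P Q R" "AB.bil P" "BD.bil R"
    and "sweedler_operator_pair.inverse_forms s W \<epsilon> r (flip U) \<eta> Q Q'"
  shows "yang_baxter (flip W) V (flip U) P Q' R"
proof -
  interpret sw: sweedler_operator_triple t V \<delta> s W \<epsilon> r "flip U" \<eta>
    by (intro sweedler_operator_triple.intro sweedler_operator_flip
        A.sweedler_operator_axioms B.sweedler_operator_axioms D.sweedler_operator_axioms)
  interpret fl: sweedler_operator_triple t V \<delta> s "flip W" \<epsilon> r U \<eta>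
    by (intro sweedler_operator_triple.intro sweedler_operator_flip
        A.sweedler_operator_axioms B.sweedler_operator_axioms D.sweedler_operator_axioms)
  have "yang_baxter V (flip W) (flip (flip U)) (\<lambda>d c. P c d) R Q'"
    by (rule sw.yang_baxter_inverse3[OF yang_baxter_swap[OF assms(1)]])
      (use assms(2-4) in \<open>auto simp: bilinear_map_times_iff\<close>)
  from fl.yang_baxter_swap[OF this[unfolded flip_flip]] show ?thesis .
qed

end

section \<open>The double of an oriented quantum coalgebra\<close>

lemma is_form_inverse_iff:
  assumes "is_coalgebra C" "bilinear_form C b"
  shows "is_form_inverse C b f \<longleftrightarrow>
    sweedler_operator_pair.inverse_forms (smult C) (sweedler C) (counit C)
      (smult C) (sweedler C) (counit C) b f"
proof -
  interpret sweedler_operator "smult C" "sweedler C" "counit C"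
    using assms(1) by (simp add: is_coalgebra_iff)
  interpret sweedler_operator_pair "smult C" "sweedler C" "counit C" "smult C" "sweedler C" "counit C" ..
  show ?thesis
    using assms(2)
    by (auto simp: is_form_inverse_def inverse_forms_def bilinear_form_def conv_def fun_eq_iff)
qed

text \<open>Uniqueness of inverses evaluates the definite description, so exhibiting one inverse
  determines \<open>form_inverse\<close>.\<close>

lemma form_inverse_eqI:
  assumes "is_coalgebra C" "bilinear_form C b" "is_form_inverse C b f"
  shows "form_inverse C b = f"
proof -
  interpret sweedler_operator "smult C" "sweedler C" "counit C"
    using assms(1) by (simp add: is_coalgebra_iff)
  interpret sweedler_operator_pair "smult C" "sweedler C" "counit C" "smult C" "sweedler C" "counit C" ..
  show ?thesis
    unfolding form_inverse_def
    using assms(3) inverse_forms_unique is_form_inverse_iff[OF assms(1,2)] by (intro the_equality) auto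
qed

locale oriented_quantum_coalgebra_data =
  fixes C :: "('k::field, 'c::ab_group_add) coalgebra"
    and b :: "'c \<Rightarrow> 'c \<Rightarrow> 'k" and Td Tu :: "'c \<Rightarrow> 'c"
  assumes oriented: "oriented_quantum_coalgebra C b Td Tu"
begin

abbreviation "s \<equiv> smult C"
abbreviation "W \<equiv> sweedler C"
abbreviation "\<epsilon> \<equiv> counit C"
abbreviation "b' \<equiv> form_inverse C b"

lemma coalgebra: "is_coalgebra C"
  using oriented by (simp add: oriented_quantum_coalgebra_def)

sublocale sweedler_operator s W \<epsilon>
  using coalgebra by (simp add: is_coalgebra_iff)

sublocale sweedler_operator_pair s W \<epsilon> s W \<epsilon> ..

lemma inverse_b: "inverse_forms b b'"
proof -
  have b: "bilinear_form C b" and "\<exists>f. is_form_inverse C b f"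
    using oriented by (simp_all add: oriented_quantum_coalgebra_def invertible_form_def)
  then show ?thesis
    using form_inverse_eqI[OF coalgebra b] is_form_inverse_iff[OF coalgebra b] by metis
qed

lemma bil_b: "bil b" "bil b'"
  using inverse_b by (auto simp: inverse_forms_def)

lemmas b_functional = bil_b[THEN bilD(1)] bil_b[THEN bilD(2)]

lemma b_zero [simp]: "b 0 y = 0" "b x 0 = 0" "b' 0 y = 0" "b' x 0 = 0"
  using b_functional[THEN linear_zero] by auto

lemma conv_b: "W c (\<lambda>c1 c2. W d (\<lambda>d1 d2. b c1 d1 * b' c2 d2)) = \<epsilon> c * \<epsilon> d"
  "W c (\<lambda>c1 c2. W d (\<lambda>d1 d2. b' c1 d1 * b c2 d2)) = \<epsilon> c * \<epsilon> d"
  using inverse_b by (auto simp: inverse_forms_def conv_def fun_eq_iff)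

section \<open>Automorphisms preserving both b and its inverse\<close>

definition compatible :: "('c \<Rightarrow> 'c) \<Rightarrow> bool" where
  "compatible T \<longleftrightarrow> linear_automorphism C T \<and> (\<forall>c. \<epsilon> (T c) = \<epsilon> c) \<and>
     (\<forall>f\<in>{b, b'}. \<forall>c d. f (T c) (T d) = f c d) \<and>
     (\<forall>f\<in>{b, b'}. \<forall>g\<in>{b, b'}. \<forall>c d e.
        W c (\<lambda>x y. f (T x) d * g (T y) e) = W (T c) (\<lambda>x y. f x d * g y e) \<and>
        W c (\<lambda>x y. f d (T x) * g e (T y)) = W (T c) (\<lambda>x y. f d x * g e y))"

lemma compatibleD:
  assumes "compatible T"
  shows "Vector_Spaces.linear s s T" "bij T" "\<epsilon> (T c) = \<epsilon> c"
    "f \<in> {b, b'} \<Longrightarrow> f (T c) (T d) = f c d"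
    "f \<in> {b, b'} \<Longrightarrow> g \<in> {b, b'} \<Longrightarrow>
      W c (\<lambda>x y. f (T x) d * g (T y) e) = W (T c) (\<lambda>x y. f x d * g y e)"
    "f \<in> {b, b'} \<Longrightarrow> g \<in> {b, b'} \<Longrightarrow>
      W c (\<lambda>x y. f d (T x) * g e (T y)) = W (T c) (\<lambda>x y. f d x * g e y)"
  using assms unfolding compatible_def linear_automorphism_def by blast+

lemma compatible_intro:
  assumes "Vector_Spaces.linear s s T" "bij T" "\<And>c. \<epsilon> (T c) = \<epsilon> c"
    "\<And>f c d. f \<in> {b, b'} \<Longrightarrow> f (T c) (T d) = f c d"
    "\<And>f g c d e. f \<in> {b, b'} \<Longrightarrow> g \<in> {b, b'} \<Longrightarrow>
      W c (\<lambda>x y. f (T x) d * g (T y) e) = W (T c) (\<lambda>x y. f x d * g y e)"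
    "\<And>f g c d e. f \<in> {b, b'} \<Longrightarrow> g \<in> {b, b'} \<Longrightarrow>
      W c (\<lambda>x y. f d (T x) * g e (T y)) = W (T c) (\<lambda>x y. f d x * g e y)"
  shows "compatible T"
  unfolding compatible_def linear_automorphism_def
  by (intro conjI ballI allI; rule assms; assumption)

text \<open>
  \<open>b' \<circ> (T \<times> T)\<close> is again inverse to \<open>b = b \<circ> (T \<times> T)\<close>, hence equal to \<open>b'\<close>.
\<close>

lemma compatibleI:
  assumes T: "coalgebra_automorphism_wrt C {b, b'} T" and b: "\<And>c d. b (T c) (T d) = b c d"
  shows "compatible T"
proof -
  have lin: "Vector_Spaces.linear s s T" and \<epsilon>: "\<epsilon> (T c) = \<epsilon> c" for c
    using T by (auto simp: coalgebra_automorphism_wrt_def linear_automorphism_def fun_eq_iff)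
  have slots: "W c (\<lambda>x y. f (T x) d * g (T y) e) = W (T c) (\<lambda>x y. f x d * g y e)"
    "W c (\<lambda>x y. f d (T x) * g e (T y)) = W (T c) (\<lambda>x y. f d x * g e y)"
    if "f \<in> {b, b'}" "g \<in> {b, b'}" for f g c d e
    using T that unfolding coalgebra_automorphism_wrt_def by blast+
  let ?b' = "\<lambda>c d. b' (T c) (T d)"
  have "conv W W b ?b' = (\<lambda>c d. \<epsilon> c * \<epsilon> d)" "conv W W ?b' b = (\<lambda>c d. \<epsilon> c * \<epsilon> d)"
  proof -
    \<comment> \<open>The sums are treated one at a time: T leaves the second arguments while the
      first ones are fixed, then, after exchanging the sums, the first arguments.\<close>
    have move: "W c (\<lambda>x y. W d (\<lambda>u v. f (T x) (T u) * g (T y) (T v))) =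
        W (T c) (\<lambda>x y. W (T d) (\<lambda>u v. f x u * g y v))" if fg: "f \<in> {b, b'}" "g \<in> {b, b'}" for f g c d
    proof -
      have "W c (\<lambda>x y. W d (\<lambda>u v. f (T x) (T u) * g (T y) (T v))) =
          W c (\<lambda>x y. W (T d) (\<lambda>u v. f (T x) u * g (T y) v))"
        by (simp only: slots(2)[OF fg])
      also have "\<dots> = W (T d) (\<lambda>u v. W c (\<lambda>x y. f (T x) u * g (T y) v))"
        by (rule commute)
      also have "\<dots> = W (T d) (\<lambda>u v. W (T c) (\<lambda>x y. f x u * g y v))"
        by (simp only: slots(1)[OF fg])
      also have "\<dots> = W (T c) (\<lambda>x y. W (T d) (\<lambda>u v. f x u * g y v))"
        by (rule commute)
      finally show ?thesis .
    qed
    show "conv W W b ?b' = (\<lambda>c d. \<epsilon> c * \<epsilon> d)" "conv W W ?b' b = (\<lambda>c d. \<epsilon> c * \<epsilon> d)"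
      using move[of b b'] move[of b' b] by (simp_all add: conv_def fun_eq_iff b conv_b \<epsilon>)
  qed
  moreover have "bil ?b'"
    unfolding bilinear_map_times_iff
    by (intro conjI allI functional_compose[OF _ lin] b_functional)
  ultimately have "inverse_forms b ?b'"
    using bil_b by (simp add: inverse_forms_def)
  then have "b' = ?b'" using inverse_forms_unique inverse_b by blast
  then have "b' (T c) (T d) = b' c d" for c d by metis
  then show ?thesis
    using T b slots \<epsilon> unfolding compatible_def coalgebra_automorphism_wrt_def by auto
qed

text \<open>This closure is why \<open>compatible\<close> includes invariance of the forms: the
  condition for T speaks of the halves of a coproduct, not of halves already moved by U. Invariance
  first cancels the outer T, and then the condition for U applies.\<close>

lemma compatible_comp:
  assumes T: "compatible T" and U: "compatible U"
  shows "compatible (T \<circ> U)"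
proof -
  have lin: "Vector_Spaces.linear s s (T \<circ> U)" and bij: "bij (T \<circ> U)"
    using compatibleD(1,2)[OF T] compatibleD(1,2)[OF U]
    by (auto simp: Vector_Spaces.linear_iff bij_comp)
  have eps: "\<epsilon> (T (U c)) = \<epsilon> c" for c
    by (simp add: compatibleD(3)[OF T] compatibleD(3)[OF U])
  have form: "f (T (U c)) (T (U d)) = f c d" if "f \<in> {b, b'}" for f c d
    by (simp add: compatibleD(4)[OF T that] compatibleD(4)[OF U that])
  have slots: "W c (\<lambda>x y. f (T (U x)) d * g (T (U y)) e) = W (T (U c)) (\<lambda>x y. f x d * g y e)"
    "W c (\<lambda>x y. f d (T (U x)) * g e (T (U y))) = W (T (U c)) (\<lambda>x y. f d x * g e y)"
    if fg: "f \<in> {b, b'}" "g \<in> {b, b'}" for f g c d e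
  proof -
    \<comment> \<open>Surjectivity writes the fixed arguments as images under T, so that invariance
      can remove T from both places.\<close>
    obtain d' e' where de: "d = T d'" "e = T e'"
      using compatibleD(2)[OF T] by (metis bij_pointE)
    have "W c (\<lambda>x y. f (T (U x)) d * g (T (U y)) e) = W c (\<lambda>x y. f (U x) d' * g (U y) e')"
      "W c (\<lambda>x y. f d (T (U x)) * g e (T (U y))) = W c (\<lambda>x y. f d' (U x) * g e' (U y))"
      by (simp_all add: de compatibleD(4)[OF T fg(1)] compatibleD(4)[OF T fg(2)])
    moreover have "W (T (U c)) (\<lambda>x y. f x d * g y e) = W (U c) (\<lambda>x y. f (T x) d * g (T y) e)"
      "W (T (U c)) (\<lambda>x y. f d x * g e y) = W (U c) (\<lambda>x y. f d (T x) * g e (T y))"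
      by (simp_all add: compatibleD(5,6)[OF T fg])
    ultimately show "W c (\<lambda>x y. f (T (U x)) d * g (T (U y)) e) = W (T (U c)) (\<lambda>x y. f x d * g y e)"
      "W c (\<lambda>x y. f d (T (U x)) * g e (T (U y))) = W (T (U c)) (\<lambda>x y. f d x * g e y)"
      by (simp_all add: de compatibleD(4)[OF T fg(1)] compatibleD(4)[OF T fg(2)]
          compatibleD(5,6)[OF U fg])
  qed
  show ?thesis
    unfolding comp_def
    by (rule compatible_intro;
        (rule lin[unfolded comp_def] bij[unfolded comp_def] eps | (rule form slots; assumption)))
qed

lemma compatible_inv:
  assumes T: "compatible T"
  shows "compatible (inv T)"
proof -
  have T_inv: "T (inv T c) = c" "inv T (T c) = c" for c
    using compatibleD(2)[OF T] by (simp_all add: bij_is_surj bij_is_inj surj_f_inv_f)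
  have lin: "Vector_Spaces.linear s s (inv T)"
    using compatibleD(1)[OF T] T_inv unfolding Vector_Spaces.linear_iff by metis
  have eps: "\<epsilon> (inv T c) = \<epsilon> c" for c
    using compatibleD(3)[OF T] T_inv by metis
  have form: "f (inv T c) d = f c (T d)" "f d (inv T c) = f (T d) c"
    if "f \<in> {b, b'}" for f c d
    using compatibleD(4)[OF T that] T_inv by metis+
  have form_inv: "f (inv T c) (inv T d) = f c d" if "f \<in> {b, b'}" for f c d
    by (simp add: form(1)[OF that] T_inv)
  have slots: "W c (\<lambda>x y. f (inv T x) d * g (inv T y) e) = W (inv T c) (\<lambda>x y. f x d * g y e)"
    "W c (\<lambda>x y. f d (inv T x) * g e (inv T y)) = W (inv T c) (\<lambda>x y. f d x * g e y)"
    if fg: "f \<in> {b, b'}" "g \<in> {b, b'}" for f g c d e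
    \<comment> \<open>The condition for T is taken at \<open>inv T c\<close> with fixed arguments in
      the image of T, where invariance cancels T.\<close>
    using compatibleD(5)[OF T fg, of "inv T c" "T d" "T e"]
      compatibleD(6)[OF T fg, of "inv T c" "T d" "T e"]
    by (simp_all add: T_inv compatibleD(4)[OF T fg(1)] compatibleD(4)[OF T fg(2)]
        form[OF fg(1)] form[OF fg(2)])
  show ?thesis
    by (rule compatible_intro;
        (rule lin bij_imp_bij_inv[OF compatibleD(2)[OF T]] eps | (rule form_inv slots; assumption)))
qed

lemma compatible_T: "compatible Td" "compatible Tu"
  using oriented by (auto simp: oriented_quantum_coalgebra_def intro!: compatibleI)

section \<open>The twist \<open>E\<close>, its inverse \<open>F\<close>, and (qc.1)\<close>

definition E :: "'c \<Rightarrow> 'c" where "E = inv Td \<circ> inv Tu"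

definition F :: "'c \<Rightarrow> 'c" where "F = Td \<circ> Tu"

lemma compatible_EF: "compatible E" "compatible F"
  unfolding E_def F_def by (intro compatible_comp compatible_inv compatible_T)+

lemma Td_Tu: "Td (Tu c) = Tu (Td c)"
  using oriented by (metis comp_apply oriented_quantum_coalgebra_def)

lemma inverse_T: "Td (inv Td c) = c" "inv Td (Td c) = c" "Tu (inv Tu c) = c" "inv Tu (Tu c) = c"
  using compatible_T[THEN compatibleD(2)] by (simp_all add: bij_is_surj bij_is_inj surj_f_inv_f)

lemma E_F: "E (F c) = c" "F (E c) = c"
  by (simp_all add: E_def F_def Td_Tu inverse_T)

lemma E_T: "E (Td c) = Td (E c)" "E (Tu c) = Tu (E c)" "Td (Tu (E c)) = c" "Tu (Td (E c)) = c"
  by (metis E_F F_def Td_Tu comp_apply)+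

lemma E_zero [simp]: "E 0 = 0"
  by (rule linear_zero[OF compatibleD(1)[OF compatible_EF(1)]])

text \<open>Invariance under \<open>E\<close> carries the twist to the other argument of a form,
  where it reappears as its inverse \<open>F\<close>.\<close>

lemma form_E: "b (E x) y = b x (F y)" "b' x (E y) = b' (F x) y"
  using compatible_EF(1)[THEN compatibleD(4), of b x "F y"]
    compatible_EF(1)[THEN compatibleD(4), of b' "F x" y] by (simp_all add: E_F)

text \<open>\<open>E \<circ> Tu\<close> is the inverse of \<open>Td\<close> and
  \<open>E \<circ> Td\<close> that of \<open>Tu\<close>, so invariance shifts either map to the
  other argument.\<close>

lemma form_T:
  assumes "f \<in> {b, b'}"
  shows "f (Td x) y = f x (E (Tu y))" "f x (Tu y) = f (E (Td x)) y"
  using compatible_T(1)[THEN compatibleD(4), OF assms, of x "E (Tu y)"]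
    compatible_T(2)[THEN compatibleD(4), OF assms, of "E (Td x)" y]
  by (simp_all add: E_T)

lemma qc1:
  "W c (\<lambda>c1 c2. W d (\<lambda>d1 d2. b c1 (Tu d2) * b' (Td c2) d1)) = \<epsilon> c * \<epsilon> d"
  "W c (\<lambda>c1 c2. W d (\<lambda>d1 d2. b' (Td c1) d2 * b c2 (Tu d1))) = \<epsilon> c * \<epsilon> d"
  using oriented by (auto simp: oriented_quantum_coalgebra_def)

text \<open>In (qc.1) \<open>Tu\<close> stands on one half of d only. Invariance under
  \<open>Tu\<close> rewrites \<open>b' (Td c2) d1\<close> as \<open>b' (F c2) (Tu d1)\<close>, so
  that \<open>Tu\<close> stands on both halves and is absorbed into d; starting from
  \<open>inv Tu d\<close> removes it.\<close>

lemma qc1_second: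
  "W c (\<lambda>c1 c2. W d (\<lambda>d1 d2. b c1 d2 * b' c2 (E d1))) = \<epsilon> c * \<epsilon> d"
  "W c (\<lambda>c1 c2. W d (\<lambda>d1 d2. b' c1 (E d2) * b c2 d1)) = \<epsilon> c * \<epsilon> d"
proof -
  define d0 where "d0 = inv Tu d"
  then have d: "d = Tu d0" "\<epsilon> d0 = \<epsilon> d"
    using inverse_T compatibleD(3)[OF compatible_T(2)] by metis+
  have *: "W d (\<lambda>d1 d2. f p d1 * g q d2) = W d0 (\<lambda>d1 d2. f p (Tu d1) * g q (Tu d2))"
    if "f \<in> {b, b'}" "g \<in> {b, b'}" for f g p q
    unfolding d by (rule compatibleD(6)[OF compatible_T(2) that, symmetric])
  have **: "b' (F x) (Tu y) = b' (Td x) y" for x y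
    using compatibleD(4)[OF compatible_T(2), of b' "Td x" y] by (simp add: F_def Td_Tu)
  have "W d (\<lambda>d1 d2. b c1 d2 * b' c2 (E d1)) = W d0 (\<lambda>d1 d2. b c1 (Tu d2) * b' (Td c2) d1)"
    for c1 c2 using *[of b' b "F c2" c1] by (simp add: form_E ** mult.commute)
  then show "W c (\<lambda>c1 c2. W d (\<lambda>d1 d2. b c1 d2 * b' c2 (E d1))) = \<epsilon> c * \<epsilon> d"
    by (simp add: qc1 d(2))
  have "W d (\<lambda>d1 d2. b' c1 (E d2) * b c2 d1) = W d0 (\<lambda>d1 d2. b' (Td c1) d2 * b c2 (Tu d1))"
    for c1 c2 using *[of b b' c2 "F c1"] by (simp add: form_E ** mult.commute)
  then show "W c (\<lambda>c1 c2. W d (\<lambda>d1 d2. b' c1 (E d2) * b c2 d1)) = \<epsilon> c * \<epsilon> d"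
    by (simp add: qc1 d(2))
qed

text \<open>The previous identities at \<open>E c\<close>: absorbing \<open>E\<close> and cancelling
  it by invariance in the factor b' leaves the twist on the first argument of b, which is how
  \<open>\<beta>'\<close> contains it.\<close>

lemma qc1_first:
  "W c (\<lambda>c1 c2. W d (\<lambda>d1 d2. b (E c1) d2 * b' c2 d1)) = \<epsilon> c * \<epsilon> d"
  "W c (\<lambda>c1 c2. W d (\<lambda>d1 d2. b' c1 d2 * b (E c2) d1)) = \<epsilon> c * \<epsilon> d"
proof -
  have *: "W c (\<lambda>c1 c2. W d (\<lambda>d1 d2. f (E c1) (p d1 d2) * g (E c2) (q d1 d2))) =
      W (E c) (\<lambda>c1 c2. W d (\<lambda>d1 d2. f c1 (p d1 d2) * g c2 (q d1 d2)))"
    if fg: "f \<in> {b, b'}" "g \<in> {b, b'}" for f g p q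
  proof -
    have "W c (\<lambda>c1 c2. W d (\<lambda>d1 d2. f (E c1) (p d1 d2) * g (E c2) (q d1 d2))) =
        W d (\<lambda>d1 d2. W c (\<lambda>c1 c2. f (E c1) (p d1 d2) * g (E c2) (q d1 d2)))"
      by (rule commute)
    also have "\<dots> = W d (\<lambda>d1 d2. W (E c) (\<lambda>c1 c2. f c1 (p d1 d2) * g c2 (q d1 d2)))"
      by (simp only: compatibleD(5)[OF compatible_EF(1) fg])
    also have "\<dots> = W (E c) (\<lambda>c1 c2. W d (\<lambda>d1 d2. f c1 (p d1 d2) * g c2 (q d1 d2)))"
      by (rule commute)
    finally show ?thesis .
  qed
  show "W c (\<lambda>c1 c2. W d (\<lambda>d1 d2. b (E c1) d2 * b' c2 d1)) = \<epsilon> c * \<epsilon> d"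
    "W c (\<lambda>c1 c2. W d (\<lambda>d1 d2. b' c1 d2 * b (E c2) d1)) = \<epsilon> c * \<epsilon> d"
    using qc1_second[of "E c" d] *[of b b' "\<lambda>x y. y" "\<lambda>x y. E x"] *[of b' b "\<lambda>x y. E y" "\<lambda>x y. x"]
      compatible_EF(1)[THEN compatibleD(3)]
    by (simp_all add: compatible_EF(1)[THEN compatibleD(4)])
qed

text \<open>The restriction of \<open>\<beta>\<close> to C times C^cop, named so that it can enter
  the Yang-Baxter identities as one form.\<close>

definition u :: "'c \<Rightarrow> 'c \<Rightarrow> 'k" where "u c d = b' c (E d)"

lemma bil_u: "bil u"
  unfolding bilinear_map_times_iff u_def
  by (intro conjI allI functional_compose[OF _ compatibleD(1)[OF compatible_EF(1)]] b_functional)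

section \<open>Yang-Baxter identities for mixed coproducts\<close>

abbreviation "V \<equiv> flip W"

lemma V: "sweedler_operator s V \<epsilon>"
  by (rule sweedler_operator_flip[OF sweedler_operator_axioms])

interpretation WV: sweedler_operator_pair s W \<epsilon> s V \<epsilon>
  by (intro sweedler_operator_pair.intro sweedler_operator_axioms V)
interpretation VW: sweedler_operator_pair s V \<epsilon> s W \<epsilon>
  by (intro sweedler_operator_pair.intro sweedler_operator_axioms V)
interpretation VV: sweedler_operator_pair s V \<epsilon> s V \<epsilon>
  by (intro sweedler_operator_pair.intro V)

lemma inverse_u: "WV.inverse_forms b u" "VW.inverse_forms b u" "VV.inverse_forms b b'"
proof -
  show "WV.inverse_forms b u"
    using qc1_second bil_b bil_u
    by (simp add: WV.inverse_forms_def conv_def flip_def fun_eq_iff u_def)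
  from inverse_forms_flip[OF WV.sweedler_operator_pair_axioms this]
  show "VW.inverse_forms b u" by simp
  show "VV.inverse_forms b b'"
    by (rule inverse_forms_flip[OF sweedler_operator_pair_axioms inverse_b])
qed

interpretation WWW: sweedler_operator_triple s W \<epsilon> s W \<epsilon> s W \<epsilon> ..
interpretation WVV: sweedler_operator_triple s W \<epsilon> s V \<epsilon> s V \<epsilon> ..
interpretation VVW: sweedler_operator_triple s V \<epsilon> s V \<epsilon> s W \<epsilon> ..
interpretation WWV: sweedler_operator_triple s W \<epsilon> s W \<epsilon> s V \<epsilon> ..

lemma yang_baxter_b: "yang_baxter W W W b b b"
  using oriented by (simp add: oriented_quantum_coalgebra_def qc3_def yang_baxter_def)

text \<open>The operators record the summand of each argument, W for C and V for C^cop, and the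
  forms are the values of \<open>\<beta>\<close> there: b on equal summands, u on (W, V), b' on (V,
  W). Together with (qc.3) itself these are all eight combinations.\<close>

lemma yang_baxter_double:
  "yang_baxter V V V b b b"
  "yang_baxter W V W u b b'" "yang_baxter V W V b' b u"
  "yang_baxter V V W b b' b'" "yang_baxter W W V b u u"
  "yang_baxter V W W b' b' b" "yang_baxter W V V u u b"
proof -
  have E: "W e (\<lambda>e1 e2. b' x (E e1) * b' y (E e2)) = W (E e) (\<lambda>e1 e2. b' x e1 * b' y e2)"
    "W e (\<lambda>e1 e2. b' x (E e2) * b' y (E e1)) = W (E e) (\<lambda>e1 e2. b' x e2 * b' y e1)" for e x y
    using compatibleD(6)[OF compatible_EF(1), of b' b' e x y]
      compatibleD(6)[OF compatible_EF(1), of b' b' e y x] by (simp_all add: mult.commute)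
  have F: "W c (\<lambda>c1 c2. b' (F c1) x * b' (F c2) y) = W (F c) (\<lambda>c1 c2. b' c1 x * b' c2 y)"
    "W c (\<lambda>c1 c2. b' (F c2) x * b' (F c1) y) = W (F c) (\<lambda>c1 c2. b' c2 x * b' c1 y)" for c x y
    using compatibleD(5)[OF compatible_EF(2), of b' b' c x y]
      compatibleD(5)[OF compatible_EF(2), of b' b' c y x] by (simp_all add: mult.commute)
  show "yang_baxter V V V b b b" by (rule yang_baxter_flip[OF yang_baxter_b])
  have WVV: "yang_baxter W V V b b b'"
    by (rule WWW.yang_baxter_inverse3[OF yang_baxter_b bil_b(1) bil_b(1) inverse_b])
  have VVW: "yang_baxter V V W b' b b"
    by (rule WWW.yang_baxter_inverse1[OF yang_baxter_b inverse_b bil_b(1) bil_b(1)])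
  from yang_baxter_flip[OF WVV.yang_baxter_inverse1[OF WVV inverse_u(1) bil_b(1) bil_b(2)]]
  show "yang_baxter W V W u b b'" by simp
  from VVW.yang_baxter_inverse3[OF VVW bil_b(2) bil_b(1) inverse_u(2)]
  show "yang_baxter V W V b' b u" by simp
  from WVV.yang_baxter_inverse2[OF WVV bil_b(1) bil_b(2)] inverse_b
  show *: "yang_baxter V V W b b' b'" by simp
  from yang_baxter_flip[OF *] have "yang_baxter W W V b b' b'" by simp
  \<comment> \<open>Both forms b' share the third argument, so twisting it by \<open>E\<close> turns
    both into u at once.\<close>
  then have "yang_baxter W W V b (\<lambda>c e. b' c (E e)) (\<lambda>d e. b' d (E e))"
    by (rule WWV.yang_baxter_twist3)
      (simp_all add: flip_def E)
  then show "yang_baxter W W V b u u" by (simp add: u_def[abs_def])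
  from VVW.yang_baxter_inverse2[OF VVW bil_b(2) bil_b(1)] inverse_u(3)
  have **: "yang_baxter W V V b' b' b" by simp
  from yang_baxter_flip[OF **] show "yang_baxter V W W b' b' b" by simp
  \<comment> \<open>Now both forms b' share the first argument. Since
    \<open>b' (F c) e = u c e\<close>, a twist by \<open>F\<close> is needed there, and the reversal
    brings that argument into the third place.\<close>
  have "yang_baxter V V W (\<lambda>e d. b d e) (\<lambda>e c. b' c e) (\<lambda>d c. b' c d)"
    by (rule WVV.yang_baxter_reverse[OF **])
  then have "yang_baxter V V W (\<lambda>e d. b d e) (\<lambda>e c. b' (F c) e) (\<lambda>d c. b' (F c) d)"
    by (rule VVW.yang_baxter_twist3)
      (simp_all add: F)
  from VVW.yang_baxter_reverse[OF this]
  show "yang_baxter W V V u u b" by (simp add: u_def[abs_def] form_E)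
qed

text \<open>These are the sums in (qc.1) for \<open>\<beta>\<close> with arguments from different
  summands. By \<open>form_T\<close> either \<open>Td\<close> stands on both halves of c or
  \<open>Tu\<close> on both halves of d; once it is absorbed, invertibility of b remains.\<close>

lemma qc1_mixed:
  "W c (\<lambda>c1 c2. W d (\<lambda>d1 d2. b' c1 (E (Tu d1)) * b (Td c2) d2)) = \<epsilon> c * \<epsilon> d"
  "W c (\<lambda>c1 c2. W d (\<lambda>d1 d2. b (Td c1) d1 * b' c2 (E (Tu d2)))) = \<epsilon> c * \<epsilon> d"
  "W c (\<lambda>c1 c2. W d (\<lambda>d1 d2. b' c2 (Tu d2) * b (E (Td c1)) d1)) = \<epsilon> c * \<epsilon> d"
  "W c (\<lambda>c1 c2. W d (\<lambda>d1 d2. b (E (Td c2)) d2 * b' c1 (Tu d1))) = \<epsilon> c * \<epsilon> d"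
proof -
  have Td: "W c (\<lambda>c1 c2. W d (\<lambda>d1 d2. f (Td c1) d1 * g (Td c2) d2)) =
      W (Td c) (\<lambda>c1 c2. W d (\<lambda>d1 d2. f c1 d1 * g c2 d2))"
    if fg: "f \<in> {b, b'}" "g \<in> {b, b'}" for f g
  proof -
    have "W c (\<lambda>c1 c2. W d (\<lambda>d1 d2. f (Td c1) d1 * g (Td c2) d2)) =
        W d (\<lambda>d1 d2. W c (\<lambda>c1 c2. f (Td c1) d1 * g (Td c2) d2))"
      by (rule commute)
    also have "\<dots> = W d (\<lambda>d1 d2. W (Td c) (\<lambda>c1 c2. f c1 d1 * g c2 d2))"
      by (simp only: compatibleD(5)[OF compatible_T(1) fg])
    also have "\<dots> = W (Td c) (\<lambda>c1 c2. W d (\<lambda>d1 d2. f c1 d1 * g c2 d2))"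
      by (rule commute)
    finally show ?thesis .
  qed
  have Tu: "W c (\<lambda>c1 c2. W d (\<lambda>d1 d2. f c1 (Tu d1) * g c2 (Tu d2))) =
      W c (\<lambda>c1 c2. W (Tu d) (\<lambda>d1 d2. f c1 d1 * g c2 d2))"
    if fg: "f \<in> {b, b'}" "g \<in> {b, b'}" for f g
    by (simp only: compatibleD(6)[OF compatible_T(2) fg])
  have form: "b' x (E (Tu y)) = b' (Td x) y" "b (E (Td x)) y = b x (Tu y)" for x y
    using form_T[of b' x y] form_T[of b x y] by simp_all
  show "W c (\<lambda>c1 c2. W d (\<lambda>d1 d2. b' c1 (E (Tu d1)) * b (Td c2) d2)) = \<epsilon> c * \<epsilon> d"
    "W c (\<lambda>c1 c2. W d (\<lambda>d1 d2. b (Td c1) d1 * b' c2 (E (Tu d2)))) = \<epsilon> c * \<epsilon> d"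
    unfolding form using Td[of b b'] Td[of b' b]
    by (simp_all add: conv_b compatibleD(3)[OF compatible_T(1)])
  show "W c (\<lambda>c1 c2. W d (\<lambda>d1 d2. b' c2 (Tu d2) * b (E (Td c1)) d1)) = \<epsilon> c * \<epsilon> d"
    "W c (\<lambda>c1 c2. W d (\<lambda>d1 d2. b (E (Td c2)) d2 * b' c1 (Tu d1))) = \<epsilon> c * \<epsilon> d"
    unfolding form using Tu[of b b'] Tu[of b' b] conv_b[of c "Tu d"]
    by (simp_all add: compatibleD(3)[OF compatible_T(2)] mult.commute)
qed

section \<open>Linearity and Sweedler sums on the double\<close>

abbreviation "CC \<equiv> coalgebra_sum C (cop C)"
abbreviation "ss \<equiv> smult CC"
abbreviation "\<beta> \<equiv> double_form C b Td Tu"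
abbreviation "S \<equiv> double_antipode Td Tu"

text \<open>The quantum coalgebra axiom for the inverse form forces this candidate; it has its own
  name until it is proved to be \<open>form_inverse CC \<beta>\<close>.\<close>

definition \<beta>' :: "'c \<times> 'c \<Rightarrow> 'c \<times> 'c \<Rightarrow> 'k" where "\<beta>' x y = \<beta> (S x) y"

lemma S_eq: "S x = (E (snd x), fst x)"
  by (simp add: double_antipode_def E_def split_beta)

lemma \<beta>_eq:
  "\<beta> x y = b (fst x) (fst y) + b (snd x) (snd y) + b' (snd x) (fst y) + b' (fst x) (E (snd y))"
  by (simp add: double_form_def E_def split_beta)

lemma \<beta>'_eq:
  "\<beta>' x y = b (E (snd x)) (fst y) + b (fst x) (snd y) + b' (fst x) (fst y) + b' (snd x) (snd y)"
  by (simp add: \<beta>'_def \<beta>_eq S_eq compatibleD(4)[OF compatible_EF(1)])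

lemma vector_space_s: "vector_space s"
  using functional_counit by (simp add: functional_iff)

lemma linear_CC:
  "vector_space ss" "Vector_Spaces.linear s ss (\<lambda>x. (x, 0))"
  "Vector_Spaces.linear ss s fst" "Vector_Spaces.linear ss s snd"
  using linear_coalgebra_sum[of C "cop C"] vector_space_s by simp_all

lemma linear_pair:
  assumes "Vector_Spaces.linear ss s f" "Vector_Spaces.linear ss s g"
  shows "Vector_Spaces.linear ss ss (\<lambda>x. (f x, g x))"
proof -
  have "fst (ss a x) = s a (fst x)" "snd (ss a x) = s a (snd x)" for a x
    using linear_CC(3,4) unfolding Vector_Spaces.linear_iff by blast+
  then show ?thesis
    using assms by (simp add: Vector_Spaces.linear_iff prod_eq_iff del: split_paired_All)
qed

abbreviation both :: "('c \<Rightarrow> 'c) \<Rightarrow> 'c \<times> 'c \<Rightarrow> 'c \<times> 'c" where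
  "both T \<equiv> (\<lambda>(c, d). (T c, T d))"

lemma linear_both:
  assumes "compatible T"
  shows "Vector_Spaces.linear ss ss (both T)"
  unfolding split_beta
  by (intro linear_pair linear_compose[OF compatibleD(1)[OF assms]] linear_CC)

lemma linear_S: "Vector_Spaces.linear ss ss S"
  unfolding S_eq[abs_def]
  by (intro linear_pair linear_compose[OF compatibleD(1)[OF compatible_EF(1)]] linear_CC)

lemma functional_fst: "functional s f \<Longrightarrow> functional ss (\<lambda>x. f (fst x))"
  and functional_snd: "functional s f \<Longrightarrow> functional ss (\<lambda>x. f (snd x))"
  using linear_CC(3,4) by (auto intro: functional_compose)

lemma functional_inr: "functional ss f \<Longrightarrow> functional s (\<lambda>x. f (0, x))"
  using linear_coalgebra_sum(3)[of C "cop C"] vector_space_s by (auto intro: functional_compose)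

lemma functional_\<beta>: "functional ss (\<lambda>y. \<beta> x y)" "functional ss (\<lambda>x. \<beta> x y)"
  unfolding \<beta>_eq
  by (intro functional_intros functional_fst functional_snd b_functional
      bilD(1)[OF bil_u, unfolded u_def])+

lemma functional_\<beta>': "functional ss (\<lambda>y. \<beta>' x y)" "functional ss (\<lambda>x. \<beta>' x y)"
  unfolding \<beta>'_def
  by (intro functional_\<beta>(1) functional_compose[OF functional_\<beta>(2) linear_S])+

text \<open>Splitting a Sweedler sum over \<open>CC\<close> requires linearity of the integrand in
  each variable; these rules discharge it for integrands built from the two forms, the antipode and
  the two automorphisms.\<close>

lemmas functional_rules = functional_intros functional_\<beta> functional_\<beta>'
  functional_compose[OF functional_\<beta>(1) linear_both[OF compatible_T(1)]]
  functional_compose[OF functional_\<beta>(1) linear_both[OF compatible_T(2)]]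
  functional_compose[OF functional_\<beta>(2) linear_both[OF compatible_T(1)]]
  functional_compose[OF functional_\<beta>(2) linear_both[OF compatible_T(2)]]
  functional_compose[OF functional_\<beta>'(1) linear_both[OF compatible_T(1)]]
  functional_compose[OF functional_\<beta>'(1) linear_both[OF compatible_T(2)]]
  functional_compose[OF functional_\<beta>'(2) linear_both[OF compatible_T(1)]]
  functional_compose[OF functional_\<beta>'(2) linear_both[OF compatible_T(2)]]
  functional_compose[OF functional_\<beta>(1) linear_S] functional_compose[OF functional_\<beta>(2) linear_S]

lemma coalgebra_CC: "is_coalgebra CC"
  by (intro is_coalgebra_sum is_coalgebra_cop coalgebra)

interpretation CC: sweedler_operator ss "sweedler CC" "counit CC"
  using coalgebra_CC by (simp add: is_coalgebra_iff)

lemma counit_CC: "counit CC x = \<epsilon> (fst x) + \<epsilon> (snd x)"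
  by (simp add: coalgebra_sum_def Let_def split_beta)

lemma sweedler_CC:
  assumes "\<And>x. functional ss (\<lambda>y. f x y)" "\<And>y. functional ss (\<lambda>x. f x y)"
  shows "sweedler CC x f =
    W (fst x) (\<lambda>u v. f (u, 0) (v, 0)) + V (snd x) (\<lambda>u v. f (0, u) (0, v))"
proof -
  have "bilinear_form C (\<lambda>u v. f (0, u) (0, v))"
    unfolding bilinear_form_def bilinear_map_times_iff
    by (intro conjI allI functional_inr assms)
  then show ?thesis
    using assms by (simp add: sweedler_coalgebra_sum bilinear_form_def bilinear_map_times_iff sweedler_cop)
qed

lemma sweedler_CC2:
  assumes "\<And>p q r. functional ss (\<lambda>x. f x p q r)" "\<And>p q r. functional ss (\<lambda>x. f p x q r)"
    "\<And>p q r. functional ss (\<lambda>x. f p q x r)" "\<And>p q r. functional ss (\<lambda>x. f p q r x)"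
  shows "sweedler CC x (\<lambda>x1 x2. sweedler CC y (\<lambda>y1 y2. f x1 x2 y1 y2)) =
    W (fst x) (\<lambda>x1 x2. W (fst y) (\<lambda>y1 y2. f (x1, 0) (x2, 0) (y1, 0) (y2, 0))) +
    W (fst x) (\<lambda>x1 x2. V (snd y) (\<lambda>y1 y2. f (x1, 0) (x2, 0) (0, y1) (0, y2))) +
    V (snd x) (\<lambda>x1 x2. W (fst y) (\<lambda>y1 y2. f (0, x1) (0, x2) (y1, 0) (y2, 0))) +
    V (snd x) (\<lambda>x1 x2. V (snd y) (\<lambda>y1 y2. f (0, x1) (0, x2) (0, y1) (0, y2)))"
proof -
  have "sweedler CC x (\<lambda>x1 x2. sweedler CC y (\<lambda>y1 y2. f x1 x2 y1 y2)) =
      W (fst x) (\<lambda>x1 x2. sweedler CC y (\<lambda>y1 y2. f (x1, 0) (x2, 0) y1 y2)) +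
      V (snd x) (\<lambda>x1 x2. sweedler CC y (\<lambda>y1 y2. f (0, x1) (0, x2) y1 y2))"
    by (intro sweedler_CC CC.functional_inner assms)
  then show ?thesis
    by (simp add: sweedler_CC assms add sweedler_operator.add[OF V])
qed

lemma sweedler_CC3:
  assumes "\<And>p q r t w. functional ss (\<lambda>x. f x p q r t w)" "\<And>p q r t w. functional ss (\<lambda>x. f p x q r t w)"
    "\<And>p q r t w. functional ss (\<lambda>x. f p q x r t w)" "\<And>p q r t w. functional ss (\<lambda>x. f p q r x t w)"
    "\<And>p q r t w. functional ss (\<lambda>x. f p q r t x w)" "\<And>p q r t w. functional ss (\<lambda>x. f p q r t w x)"
  shows "sweedler CC x (\<lambda>x1 x2. sweedler CC y (\<lambda>y1 y2. sweedler CC z (\<lambda>z1 z2. f x1 x2 y1 y2 z1 z2))) =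
    W (fst x) (\<lambda>x1 x2. W (fst y) (\<lambda>y1 y2. W (fst z) (\<lambda>z1 z2. f (x1, 0) (x2, 0) (y1, 0) (y2, 0) (z1, 0) (z2, 0)))) +
    W (fst x) (\<lambda>x1 x2. W (fst y) (\<lambda>y1 y2. V (snd z) (\<lambda>z1 z2. f (x1, 0) (x2, 0) (y1, 0) (y2, 0) (0, z1) (0, z2)))) +
    W (fst x) (\<lambda>x1 x2. V (snd y) (\<lambda>y1 y2. W (fst z) (\<lambda>z1 z2. f (x1, 0) (x2, 0) (0, y1) (0, y2) (z1, 0) (z2, 0)))) +
    W (fst x) (\<lambda>x1 x2. V (snd y) (\<lambda>y1 y2. V (snd z) (\<lambda>z1 z2. f (x1, 0) (x2, 0) (0, y1) (0, y2) (0, z1) (0, z2)))) +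
    V (snd x) (\<lambda>x1 x2. W (fst y) (\<lambda>y1 y2. W (fst z) (\<lambda>z1 z2. f (0, x1) (0, x2) (y1, 0) (y2, 0) (z1, 0) (z2, 0)))) +
    V (snd x) (\<lambda>x1 x2. W (fst y) (\<lambda>y1 y2. V (snd z) (\<lambda>z1 z2. f (0, x1) (0, x2) (y1, 0) (y2, 0) (0, z1) (0, z2)))) +
    V (snd x) (\<lambda>x1 x2. V (snd y) (\<lambda>y1 y2. W (fst z) (\<lambda>z1 z2. f (0, x1) (0, x2) (0, y1) (0, y2) (z1, 0) (z2, 0)))) +
    V (snd x) (\<lambda>x1 x2. V (snd y) (\<lambda>y1 y2. V (snd z) (\<lambda>z1 z2. f (0, x1) (0, x2) (0, y1) (0, y2) (0, z1) (0, z2))))"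
proof -
  have "sweedler CC x (\<lambda>x1 x2. sweedler CC y (\<lambda>y1 y2. sweedler CC z (\<lambda>z1 z2. f x1 x2 y1 y2 z1 z2))) =
      W (fst x) (\<lambda>x1 x2. sweedler CC y (\<lambda>y1 y2. sweedler CC z (\<lambda>z1 z2. f (x1, 0) (x2, 0) y1 y2 z1 z2))) +
      V (snd x) (\<lambda>x1 x2. sweedler CC y (\<lambda>y1 y2. sweedler CC z (\<lambda>z1 z2. f (0, x1) (0, x2) y1 y2 z1 z2)))"
    by (intro sweedler_CC CC.functional_inner assms)
  then show ?thesis
    by (simp add: sweedler_CC2 assms add sweedler_operator.add[OF V])
qed

section \<open>Invertibility and (qc.3) for \<open>\<beta>\<close>\<close>

lemma \<beta>_simps:
  "\<beta> (x, 0) (y, 0) = b x y" "\<beta> (0, x) (0, y) = b x y"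
  "\<beta> (0, x) (y, 0) = b' x y" "\<beta> (x, 0) (0, y) = u x y"
  by (simp_all add: \<beta>_eq u_def)

lemma \<beta>'_simps:
  "\<beta>' (x, 0) (y, 0) = b' x y" "\<beta>' (0, x) (0, y) = b' x y"
  "\<beta>' (0, x) (y, 0) = b (E x) y" "\<beta>' (x, 0) (0, y) = b x y"
  by (simp_all add: \<beta>'_eq)

lemma bilinear_\<beta>: "bilinear_form CC \<beta>" "bilinear_form CC \<beta>'"
  by (simp_all add: bilinear_form_def bilinear_map_times_iff functional_\<beta> functional_\<beta>')

text \<open>Each convolution splits into four sums. On equal summands they express invertibility of
  b; on C times C^cop they are \<open>qc1_second\<close>, on C^cop times C
  \<open>qc1_first\<close>.\<close>

lemma is_form_inverse_\<beta>: "is_form_inverse CC \<beta> \<beta>'"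
proof -
  have "sweedler CC c (\<lambda>c1 c2. sweedler CC d (\<lambda>d1 d2. \<beta>' c1 d1 * \<beta> c2 d2)) =
      counit CC c * counit CC d"
    for c d
  proof -
    \<comment> \<open>Reversing both coproducts exchanges the two one-sided inverse laws.\<close>
    have 1: "V (snd c) (\<lambda>c1 c2. V (snd d) (\<lambda>d1 d2. b' c1 d1 * b c2 d2)) = \<epsilon> (snd c) * \<epsilon> (snd d)"
      using conv_b(1)[of "snd c" "snd d"] by (simp add: flip_def mult.commute)
    have 2: "W (fst c) (\<lambda>c1 c2. V (snd d) (\<lambda>d1 d2. b c1 d1 * u c2 d2)) = \<epsilon> (fst c) * \<epsilon> (snd d)"
      using qc1_second(1) by (simp add: flip_def u_def)
    have 3: "V (snd c) (\<lambda>c1 c2. W (fst d) (\<lambda>d1 d2. b (E c1) d1 * b' c2 d2)) = \<epsilon> (snd c) * \<epsilon> (fst d)"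
      using qc1_first(2)[of "snd c" "fst d"] by (simp add: flip_def mult.commute)
    show ?thesis
      by (subst sweedler_CC2, (intro functional_rules)+)
        (simp add: \<beta>_simps \<beta>'_simps 1 2 3 conv_b counit_CC distrib_left distrib_right add.assoc)
  qed
  moreover have "sweedler CC c (\<lambda>c1 c2. sweedler CC d (\<lambda>d1 d2. \<beta> c1 d1 * \<beta>' c2 d2)) =
      counit CC c * counit CC d"
    for c d
  proof -
    have 1: "V (snd c) (\<lambda>c1 c2. V (snd d) (\<lambda>d1 d2. b c1 d1 * b' c2 d2)) = \<epsilon> (snd c) * \<epsilon> (snd d)"
      using conv_b(2)[of "snd c" "snd d"] by (simp add: flip_def mult.commute)
    have 2: "W (fst c) (\<lambda>c1 c2. V (snd d) (\<lambda>d1 d2. u c1 d1 * b c2 d2)) = \<epsilon> (fst c) * \<epsilon> (snd d)"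
      using qc1_second(2) by (simp add: flip_def u_def)
    have 3: "V (snd c) (\<lambda>c1 c2. W (fst d) (\<lambda>d1 d2. b' c1 d1 * b (E c2) d2)) = \<epsilon> (snd c) * \<epsilon> (fst d)"
      using qc1_first(1)[of "snd c" "fst d"] by (simp add: flip_def mult.commute)
    show ?thesis
      by (subst sweedler_CC2, (intro functional_rules)+)
        (simp add: \<beta>_simps \<beta>'_simps 1 2 3 conv_b counit_CC distrib_left distrib_right add.assoc)
  qed
  ultimately show ?thesis by (simp add: is_form_inverse_def bilinear_\<beta>)
qed

lemma form_inverse_\<beta>: "form_inverse CC \<beta> = \<beta>'"
  by (rule form_inverse_eqI[OF coalgebra_CC bilinear_\<beta>(1) is_form_inverse_\<beta>])

lemma invertible_\<beta>: "invertible_form CC \<beta>"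
  using bilinear_\<beta>(1) is_form_inverse_\<beta> by (auto simp: invertible_form_def)

lemma qc3_\<beta>: "qc3 CC \<beta>"
proof -
  note yb = yang_baxter_b yang_baxter_double
  note yb' = yb[unfolded yang_baxter_def, rule_format]
  show ?thesis
    unfolding qc3_def
  proof (intro allI)
    fix c d e
    \<comment> \<open>Both sides expand into eight sums, one for each choice of summands, and
      \<open>yb'\<close> matches them term by term.\<close>
    show "sweedler CC c (\<lambda>c1 c2. sweedler CC d (\<lambda>d1 d2. sweedler CC e (\<lambda>e1 e2.
         \<beta> c1 d1 * \<beta> c2 e1 * \<beta> d2 e2))) =
      sweedler CC c (\<lambda>c1 c2. sweedler CC d (\<lambda>d1 d2. sweedler CC e (\<lambda>e1 e2.
         \<beta> c2 d2 * \<beta> c1 e2 * \<beta> d1 e1)))"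
      by (subst sweedler_CC3, (intro functional_rules)+, subst sweedler_CC3, (intro functional_rules)+,
        simp only: \<beta>_simps yb')
  qed
qed

section \<open>Automorphism conditions for \<open>\<beta>\<close> and its inverse\<close>

definition left_form :: "('c \<Rightarrow> 'k) \<Rightarrow> bool" where
  "left_form \<phi> \<longleftrightarrow> (\<exists>p q. \<phi> = (\<lambda>c. b c p + b' c q))"

definition right_form :: "('c \<Rightarrow> 'k) \<Rightarrow> bool" where
  "right_form \<phi> \<longleftrightarrow> (\<exists>p q. \<phi> = (\<lambda>c. b p c + b' q c))"

text \<open>Automorphism conditions are known for slices of the single forms b and b'. A product of
  sums of such slices expands into four products of that kind, all with the running variable on the
  same side.\<close>

lemma compatible_forms:
  assumes T: "compatible T" and "left_form \<phi> \<and> left_form \<psi> \<or> right_form \<phi> \<and> right_form \<psi>"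
  shows "W c (\<lambda>x y. \<phi> (T x) * \<psi> (T y)) = W (T c) (\<lambda>x y. \<phi> x * \<psi> y)"
  using assms(2)
proof (elim disjE conjE)
  assume "left_form \<phi>" "left_form \<psi>"
  then obtain p q p' q' where "\<phi> = (\<lambda>c. b c p + b' c q)" "\<psi> = (\<lambda>c. b c p' + b' c q')"
    by (auto simp: left_form_def)
  then show ?thesis
    using compatibleD(5)[OF T, of b b] compatibleD(5)[OF T, of b b']
      compatibleD(5)[OF T, of b' b] compatibleD(5)[OF T, of b' b']
    by (simp add: distrib_left distrib_right add)
next
  assume "right_form \<phi>" "right_form \<psi>"
  then obtain p q p' q' where "\<phi> = (\<lambda>c. b p c + b' q c)" "\<psi> = (\<lambda>c. b p' c + b' q' c)"
    by (auto simp: right_form_def)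
  then show ?thesis
    using compatibleD(6)[OF T, of b b] compatibleD(6)[OF T, of b b']
      compatibleD(6)[OF T, of b' b] compatibleD(6)[OF T, of b' b']
    by (simp add: distrib_left distrib_right add)
qed

text \<open>Where \<open>\<beta>'\<close> applies \<open>E\<close> to the running argument,
  \<open>form_E\<close> moves it to the fixed one as \<open>F\<close>, which leaves a slice of b
  plus a slice of b'.\<close>

lemma left_form_\<beta>:
  assumes "f \<in> {\<beta>, \<beta>'}"
  shows "left_form (\<lambda>c. f (c, 0) y)" "left_form (\<lambda>c. f (0, c) y)"
proof -
  have "left_form (\<lambda>c. b c p + b' c q)" "left_form (\<lambda>c. b' c q + b c p)" for p q
    by (auto simp: left_form_def add.commute)
  then show "left_form (\<lambda>c. f (c, 0) y)" "left_form (\<lambda>c. f (0, c) y)"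
    using assms by (auto simp: \<beta>_eq \<beta>'_eq form_E(1))
qed

lemma right_form_\<beta>:
  assumes "f \<in> {\<beta>, \<beta>'}"
  shows "right_form (\<lambda>c. f x (c, 0))" "right_form (\<lambda>c. f x (0, c))"
proof -
  have "right_form (\<lambda>c. b p c + b' q c)" "right_form (\<lambda>c. b' q c + b p c)" for p q
    by (auto simp: right_form_def add.commute)
  then show "right_form (\<lambda>c. f x (c, 0))" "right_form (\<lambda>c. f x (0, c))"
    using assms by (auto simp: \<beta>_eq \<beta>'_eq form_E(2))
qed

lemma T_zero: "compatible T \<Longrightarrow> T 0 = 0"
  using linear_zero compatibleD(1) by blast

lemma functional_form:
  assumes "f \<in> {\<beta>, \<beta>'}"
  shows "functional ss (\<lambda>y. f x y)" "functional ss (\<lambda>x. f x y)"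
  using assms by (auto simp: functional_\<beta> functional_\<beta>')

lemma automorphism_both:
  assumes T: "compatible T"
  shows "coalgebra_automorphism_wrt CC {\<beta>, \<beta>'} (both T)"
  unfolding coalgebra_automorphism_wrt_def
proof (intro conjI ballI allI)
  have "bij (both T)"
  proof (rule o_bij)
    show "both (inv T) \<circ> both T = id" "both T \<circ> both (inv T) = id"
      using compatibleD(2)[OF T] by (auto simp: fun_eq_iff bij_is_inj bij_is_surj surj_f_inv_f)
  qed
  then show "linear_automorphism CC (both T)"
    by (simp add: linear_automorphism_def linear_both[OF T])
  show "counit CC \<circ> both T = counit CC"
    by (simp add: fun_eq_iff counit_CC compatibleD(3)[OF T])
next
  fix f g c d e
  assume fg: "f \<in> {\<beta>, \<beta>'}" "g \<in> {\<beta>, \<beta>'}"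
  note lin = functional_intros functional_form[OF fg(1)] functional_form[OF fg(2)]
    functional_compose[OF functional_form(1)[OF fg(1)] linear_both[OF T]]
    functional_compose[OF functional_form(1)[OF fg(2)] linear_both[OF T]]
    functional_compose[OF functional_form(2)[OF fg(1)] linear_both[OF T]]
    functional_compose[OF functional_form(2)[OF fg(2)] linear_both[OF T]]
  \<comment> \<open>The second equation has f and g exchanged because the coproduct of the other
    summand is reversed.\<close>
  have left: "W c (\<lambda>x y. f (T x, 0) d * g (T y, 0) e) = W (T c) (\<lambda>x y. f (x, 0) d * g (y, 0) e)"
    "W c (\<lambda>x y. g (0, T x) e * f (0, T y) d) = W (T c) (\<lambda>x y. g (0, x) e * f (0, y) d)" for c
    using compatible_forms[OF T disjI1[OF conjI[OF left_form_\<beta>(1)[OF fg(1)] left_form_\<beta>(1)[OF fg(2)]]]]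
      compatible_forms[OF T disjI1[OF conjI[OF left_form_\<beta>(2)[OF fg(2)] left_form_\<beta>(2)[OF fg(1)]]]]
    by simp_all
  have right: "W c (\<lambda>x y. f d (T x, 0) * g e (T y, 0)) = W (T c) (\<lambda>x y. f d (x, 0) * g e (y, 0))"
    "W c (\<lambda>x y. g e (0, T x) * f d (0, T y)) = W (T c) (\<lambda>x y. g e (0, x) * f d (0, y))" for c
    using compatible_forms[OF T disjI2[OF conjI[OF right_form_\<beta>(1)[OF fg(1)] right_form_\<beta>(1)[OF fg(2)]]]]
      compatible_forms[OF T disjI2[OF conjI[OF right_form_\<beta>(2)[OF fg(2)] right_form_\<beta>(2)[OF fg(1)]]]]
    by simp_all
  show "sweedler CC c (\<lambda>c1 c2. f (both T c1) d * g (both T c2) e) =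
      sweedler CC (both T c) (\<lambda>x1 x2. f x1 d * g x2 e)"
    by (subst sweedler_CC, (intro lin)+, subst sweedler_CC, (intro lin)+,
        simp add: T_zero[OF T] split_beta left(1) flip_def mult.commute[of "f (0, _) d"] left(2))
  show "sweedler CC c (\<lambda>c1 c2. f d (both T c1) * g e (both T c2)) =
      sweedler CC (both T c) (\<lambda>x1 x2. f d x1 * g e x2)"
    by (subst sweedler_CC, (intro lin)+, subst sweedler_CC, (intro lin)+,
        simp add: T_zero[OF T] split_beta right(1) flip_def mult.commute[of "f d (0, _)"] right(2))
qed

section \<open>The two structures on the double and the inclusion\<close>

lemma \<beta>_both:
  assumes T: "compatible T" and "\<And>c. E (T c) = T (E c)"
  shows "\<beta> (both T x) (both T y) = \<beta> x y"
  by (simp add: \<beta>_eq split_beta assms(2) compatibleD(4)[OF T])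

lemma quantum_coalgebra_double: "quantum_coalgebra CC \<beta> S"
  unfolding quantum_coalgebra_def
proof (intro conjI allI coalgebra_CC invertible_\<beta> qc3_\<beta>)
  have "bij S"
  proof (rule o_bij)
    \<comment> \<open>The inverse of S, with \<open>F\<close> undoing \<open>E\<close> on the
      component that S twists.\<close>
    show "(\<lambda>(x, y). (y, F x)) \<circ> S = id" "S \<circ> (\<lambda>(x, y). (y, F x)) = id"
      by (simp_all add: fun_eq_iff S_eq E_F)
  qed
  then show "linear_automorphism CC S"
    by (simp add: linear_automorphism_def linear_S)
  show "counit CC \<circ> S = counit CC"
    by (simp add: fun_eq_iff counit_CC S_eq compatibleD(3)[OF compatible_EF(1)])
  show "form_inverse CC \<beta> c d = \<beta> (S c) d" for c d
    by (simp add: form_inverse_\<beta> \<beta>'_def)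
  show "\<beta> c d = \<beta> (S c) (S d)" for c d
    by (simp add: \<beta>_eq S_eq compatibleD(4)[OF compatible_EF(1)])
next
  fix c d e
  \<comment> \<open>S exchanges the summands, whose coproducts are opposite, which produces the
    reversed order in the axiom. Only the component returning to C passes through \<open>E\<close>,
    and there compatibility of \<open>E\<close> is used.\<close>
  have left: "W c (\<lambda>x y. \<beta> (E x, 0) e * \<beta> (E y, 0) d) = W (E c) (\<lambda>x y. \<beta> (x, 0) e * \<beta> (y, 0) d)" for c
    using compatible_forms[OF compatible_EF(1) disjI1[OF conjI[OF left_form_\<beta>(1)[of \<beta>] left_form_\<beta>(1)[of \<beta>]]]]
    by simp
  have right: "W c (\<lambda>x y. \<beta> e (E x, 0) * \<beta> d (E y, 0)) = W (E c) (\<lambda>x y. \<beta> e (x, 0) * \<beta> d (y, 0))" for c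
    using compatible_forms[OF compatible_EF(1) disjI2[OF conjI[OF right_form_\<beta>(1)[of \<beta>] right_form_\<beta>(1)[of \<beta>]]]]
    by simp
  show "sweedler CC c (\<lambda>c1 c2. \<beta> (S c1) d * \<beta> (S c2) e) =
      sweedler CC (S c) (\<lambda>x1 x2. \<beta> x2 d * \<beta> x1 e)"
    by (subst sweedler_CC, (intro functional_rules)+, subst sweedler_CC, (intro functional_rules)+,
        simp add: S_eq flip_def mult.commute[of "\<beta> _ d" "\<beta> _ e"] left)
  show "sweedler CC c (\<lambda>c1 c2. \<beta> d (S c1) * \<beta> e (S c2)) =
      sweedler CC (S c) (\<lambda>x1 x2. \<beta> d x2 * \<beta> e x1)"
    by (subst sweedler_CC, (intro functional_rules)+, subst sweedler_CC, (intro functional_rules)+,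
        simp add: S_eq flip_def mult.commute[of "\<beta> d _" "\<beta> e _"] right)
qed

text \<open>In (qc.1) arguments from the same summand give (qc.1) for C, with both coproducts
  reversed in the case of C^cop, while arguments from different summands give
  \<open>qc1_mixed\<close>.\<close>

lemma oriented_quantum_coalgebra_double:
  "oriented_quantum_coalgebra CC \<beta> (both Td) (both Tu)"
  unfolding oriented_quantum_coalgebra_def form_inverse_\<beta>
proof (intro conjI allI coalgebra_CC invertible_\<beta> qc3_\<beta> automorphism_both compatible_T)
  show "both Td \<circ> both Tu = both Tu \<circ> both Td"
    by (simp add: fun_eq_iff Td_Tu)
  show "\<beta> c d = \<beta> (both Td c) (both Td d)" "\<beta> c d = \<beta> (both Tu c) (both Tu d)" for c d
    using \<beta>_both[OF compatible_T(1)] \<beta>_both[OF compatible_T(2)] by (simp_all add: E_T)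
  note zero = T_zero[OF compatible_T(1)] T_zero[OF compatible_T(2)]
  fix c d :: "'c \<times> 'c"
  have 1: "V (snd c) (\<lambda>c1 c2. V (snd d) (\<lambda>d1 d2. b c1 (Tu d2) * b' (Td c2) d1)) = \<epsilon> (snd c) * \<epsilon> (snd d)"
    "V (snd c) (\<lambda>c1 c2. V (snd d) (\<lambda>d1 d2. b' (Td c1) d2 * b c2 (Tu d1))) = \<epsilon> (snd c) * \<epsilon> (snd d)"
    using qc1[of "snd c" "snd d"] by (simp_all add: flip_def mult.commute)
  note 2 = qc1_mixed[of "fst c" "snd d"] qc1_mixed[of "snd c" "fst d"]
  show "sweedler CC c (\<lambda>c1 c2. sweedler CC d (\<lambda>d1 d2. \<beta> c1 (both Tu d2) * \<beta>' (both Td c2) d1)) =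
      counit CC c * counit CC d"
    by (subst sweedler_CC2, (intro functional_rules)+,
        simp add: \<beta>_simps \<beta>'_simps zero qc1 1,
        simp add: flip_def u_def 2 counit_CC distrib_left distrib_right add.assoc)
  show "sweedler CC c (\<lambda>c1 c2. sweedler CC d (\<lambda>d1 d2. \<beta>' (both Td c1) d2 * \<beta> c2 (both Tu d1))) =
      counit CC c * counit CC d"
    by (subst sweedler_CC2, (intro functional_rules)+,
        simp add: \<beta>_simps \<beta>'_simps zero qc1 1,
        simp add: flip_def u_def 2 counit_CC distrib_left distrib_right add.assoc)
qed

text \<open>Tested on a bilinear form, the coproduct of (c, 0) has the desired C part and a C^cop
  part taken at 0, which vanishes by linearity.\<close>

lemma coalgebra_map_inclusion: "is_coalgebra_map C CC (\<lambda>c. (c, 0))"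
  unfolding is_coalgebra_map_def
proof (intro conjI allI linear_CC(2))
  fix c
  show "counit CC (c, 0) = \<epsilon> c"
    by (simp add: counit_CC linear_zero[OF functional_counit])
  show "comult CC (c, 0) = tensor_map ss ss (\<lambda>c. (c, 0)) (\<lambda>c. (c, 0)) (comult C c)"
  proof (rule tensor_space_eqI[OF linear_CC(1) linear_CC(1)])
    fix f :: "'c \<times> 'c \<Rightarrow> 'c \<times> 'c \<Rightarrow> 'k"
    assume f: "bilinear_map ss ss (*) f"
    then have lin: "functional ss (\<lambda>y. f x y)" "functional ss (\<lambda>x. f x y)" for x y
      unfolding bilinear_map_times_iff by blast+
    have "V 0 (\<lambda>u v. f (0, u) (0, v)) = 0"
    proof (rule linear_zero[OF sweedler_operator.functional_W[OF V]])
      show "functional s (\<lambda>y. f (0, x) (0, y))" "functional s (\<lambda>x. f (0, x) (0, y))" for x y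
        by (intro functional_inr lin)+
    qed
    then show "tensor_lift (*) f (comult CC (c, 0)) =
        tensor_lift (*) f (tensor_map ss ss (\<lambda>c. (c, 0)) (\<lambda>c. (c, 0)) (comult C c))"
      using sweedler_CC[OF lin, of "(c, 0)"] by (simp add: tensor_lift_map[OF f] sweedler_def)
  qed (use coalgebra_CC in \<open>simp_all add: is_coalgebra_iff\<close>)
qed

lemma morphism_inclusion:
  "oriented_quantum_coalgebra_morphism C b Td Tu CC \<beta> (both Td) (both Tu) (\<lambda>c. (c, 0))"
  using oriented oriented_quantum_coalgebra_double coalgebra_map_inclusion
  by (simp add: oriented_quantum_coalgebra_morphism_def \<beta>_simps fun_eq_iff T_zero compatible_T)

lemma both_S: "both Td \<circ> S = S \<circ> both Td" "both Tu \<circ> S = S \<circ> both Tu"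
  by (simp_all add: fun_eq_iff S_eq E_T)

end

theorem theorem3:
  fixes C :: "('k::field, 'c::ab_group_add) coalgebra"
    and b :: "'c \<Rightarrow> 'c \<Rightarrow> 'k"
    and Td Tu :: "'c \<Rightarrow> 'c"
  assumes "oriented_quantum_coalgebra C b Td Tu"
  shows
    "let \<C> = coalgebra_sum C (cop C);
         \<beta> = double_form C b Td Tu;
         S = double_antipode Td Tu;
         TTd = (\<lambda>(c, d). (Td c, Td d));
         TTu = (\<lambda>(c, d). (Tu c, Tu d))
     in quantum_coalgebra \<C> \<beta> S \<and>
        (oriented_quantum_coalgebra \<C> \<beta> TTd TTu \<and> TTd \<circ> S = S \<circ> TTd \<and> TTu \<circ> S = S \<circ> TTu) \<and>
        oriented_quantum_coalgebra_morphism C b Td Tu \<C> \<beta> TTd TTu (\<lambda>c. (c, 0))"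
proof -
  interpret oriented_quantum_coalgebra_data C b Td Tu
    by standard fact
  show ?thesis
    unfolding Let_def
    by (intro conjI quantum_coalgebra_double oriented_quantum_coalgebra_double both_S
        morphism_inclusion)
qed

end
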